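(* Conjoining Bipartite Matching is solvable in $O\big(2^{c(c+1)}n + n^3\big)$ time on instances whose bipartite input graph $G=(V_1\uplus V_2,E)$ is such that each vertex in $V_1$ has degree at most two, where $c$ is the size of the join set and $n$ is the number of vertices of $G$.
   Context: Conjoining Bipartite Matching (CBM): Input: a bipartite graph $G=(V_1\uplus V_2,E)$, a number $\omega_{max}$, a weight function $\omega:E\to[0,\omega_{max}]\cup\{\infty\}$, a partition $\{C_1,\dots,C_k\}$ of the vertices, and a join set $J\subseteq\{\{i,j\}:1\le i<j\le k\}$. A join $\{i,j\}$ is satisfied by a matching $M$ if some $e\in M$ has $e\cap C_i\ne\emptyset$ and $e\cap C_j\ne\emptyset$. Question: is there a perfect matching $M$ satisfying all joins in $J$ with $\sum_{e\in M}\omega(e)\le\omega_{max}$? *)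

theory Defs
  imports "HOL-Library.Extended_Real" "HOL-Library.Disjoint_Sets"
begin

section \<open>Conjoining Bipartite Matching\<close>

record cbm =
  V1 :: "nat set"
  V2 :: "nat set"
  E :: "nat set set"
  wmax :: real
  wt :: "nat set \<Rightarrow> ereal"
  parts :: nat
  cell :: "nat \<Rightarrow> nat set"
  joins :: "nat set set"

definition verts :: "cbm \<Rightarrow> nat set" where
  "verts I = V1 I \<union> V2 I"

definition cbm_instance :: "cbm \<Rightarrow> bool" where
  "cbm_instance I \<longleftrightarrow>
     finite (V1 I) \<and> finite (V2 I) \<and> V1 I \<inter> V2 I = {} \<and>
     E I \<subseteq> {{u, v} | u v. u \<in> V1 I \<and> v \<in> V2 I} \<and>
     (\<forall>e\<in>E I. wt I e \<in> ereal ` {0..wmax I} \<union> {\<infinity>}) \<and>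
     inj_on (cell I) {1..parts I} \<and> partition_on (verts I) (cell I ` {1..parts I}) \<and>
     joins I \<subseteq> {{i, j} | i j. 1 \<le> i \<and> i < j \<and> j \<le> parts I}"

definition degree :: "cbm \<Rightarrow> nat \<Rightarrow> nat" where
  "degree I v = card {e \<in> E I. v \<in> e}"

definition matching :: "cbm \<Rightarrow> nat set set \<Rightarrow> bool" where
  "matching I M \<longleftrightarrow> M \<subseteq> E I \<and> pairwise disjnt M"

definition perfect_matching :: "cbm \<Rightarrow> nat set set \<Rightarrow> bool" where
  "perfect_matching I M \<longleftrightarrow> matching I M \<and> \<Union>M = verts I"

definition satisfies_join :: "cbm \<Rightarrow> nat set set \<Rightarrow> nat \<Rightarrow> nat \<Rightarrow> bool" where
  "satisfies_join I M i j \<longleftrightarrow> (\<exists>e\<in>M. e \<inter> cell I i \<noteq> {} \<and> e \<inter> cell I j \<noteq> {})"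

definition cbm_yes :: "cbm \<Rightarrow> bool" where
  "cbm_yes I \<longleftrightarrow>
     (\<exists>M. perfect_matching I M \<and>
          (\<forall>i j. {i, j} \<in> joins I \<longrightarrow> satisfies_join I M i j) \<and>
          (\<Sum>e\<in>M. wt I e) \<le> ereal (wmax I))"


section \<open>A uniform-cost random access machine\<close>

text \<open>
  Running times refer to structured programs over a random access memory. A program uses the
  finitely many arrays whose names occur in it. There are two sorts of arrays: those holding
  natural numbers (also used as addresses) and those holding weights, i.e. numbers or infinity.
  Natural numbers can be added, subtracted (truncating at 0) and compared; weights can only be
  copied, added and compared. In particular there is no multiplication, and no information flows
  from weights to natural numbers except through comparisons. Every operation costs one unit.
\<close>

record store =
  nmem :: "string \<Rightarrow> nat \<Rightarrow> nat"
  wmem :: "string \<Rightarrow> nat \<Rightarrow> ereal"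

datatype nexp =
    NConst nat
  | NRead string nexp
  | NAdd nexp nexp
  | NSub nexp nexp

datatype wexp =
    WZero
  | WInf
  | WRead string nexp
  | WAdd wexp wexp

datatype bexp =
    NLe nexp nexp
  | WLe wexp wexp
  | BNot bexp
  | BAnd bexp bexp

datatype com =
    Skip
  | NAssign string nexp nexp
  | WAssign string nexp wexp
  | Seq com com
  | Cond bexp com com
  | While bexp com

primrec nval :: "nexp \<Rightarrow> store \<Rightarrow> nat" where
  "nval (NConst k) s = k"
| "nval (NRead x a) s = nmem s x (nval a s)"
| "nval (NAdd a b) s = nval a s + nval b s"
| "nval (NSub a b) s = nval a s - nval b s"

primrec wval :: "wexp \<Rightarrow> store \<Rightarrow> ereal" where
  "wval WZero s = 0"
| "wval WInf s = \<infinity>"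
| "wval (WRead x a) s = wmem s x (nval a s)"
| "wval (WAdd a b) s = wval a s + wval b s"

primrec bval :: "bexp \<Rightarrow> store \<Rightarrow> bool" where
  "bval (NLe a b) s \<longleftrightarrow> nval a s \<le> nval b s"
| "bval (WLe a b) s \<longleftrightarrow> wval a s \<le> wval b s"
| "bval (BNot b) s \<longleftrightarrow> \<not> bval b s"
| "bval (BAnd a b) s \<longleftrightarrow> bval a s \<and> bval b s"

primrec ncost :: "nexp \<Rightarrow> nat" where
  "ncost (NConst k) = 1"
| "ncost (NRead x a) = 1 + ncost a"
| "ncost (NAdd a b) = 1 + ncost a + ncost b"
| "ncost (NSub a b) = 1 + ncost a + ncost b"

primrec wcost :: "wexp \<Rightarrow> nat" where
  "wcost WZero = 1"
| "wcost WInf = 1"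
| "wcost (WRead x a) = 1 + ncost a"
| "wcost (WAdd a b) = 1 + wcost a + wcost b"

primrec bcost :: "bexp \<Rightarrow> nat" where
  "bcost (NLe a b) = 1 + ncost a + ncost b"
| "bcost (WLe a b) = 1 + wcost a + wcost b"
| "bcost (BNot b) = 1 + bcost b"
| "bcost (BAnd a b) = 1 + bcost a + bcost b"

definition nupd :: "string \<Rightarrow> nat \<Rightarrow> nat \<Rightarrow> store \<Rightarrow> store" where
  "nupd x i k s = s\<lparr>nmem := (nmem s)(x := (nmem s x)(i := k))\<rparr>"

definition wupd :: "string \<Rightarrow> nat \<Rightarrow> ereal \<Rightarrow> store \<Rightarrow> store" where
  "wupd x i w s = s\<lparr>wmem := (wmem s)(x := (wmem s x)(i := w))\<rparr>"

text \<open>\<open>exec P s t s'\<close>: started in \<open>s\<close>, program \<open>P\<close> halts in \<open>s'\<close> after exactly \<open>t\<close> steps.\<close>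

inductive exec :: "com \<Rightarrow> store \<Rightarrow> nat \<Rightarrow> store \<Rightarrow> bool" where
  Skip: "exec Skip s 1 s"
| NAssign: "exec (NAssign x a b) s (1 + ncost a + ncost b) (nupd x (nval a s) (nval b s) s)"
| WAssign: "exec (WAssign x a w) s (1 + ncost a + wcost w) (wupd x (nval a s) (wval w s) s)"
| Seq: "exec P s t s' \<Longrightarrow> exec Q s' u s'' \<Longrightarrow> exec (Seq P Q) s (t + u) s''"
| IfTrue: "bval b s \<Longrightarrow> exec P s t s' \<Longrightarrow> exec (Cond b P Q) s (1 + bcost b + t) s'"
| IfFalse: "\<not> bval b s \<Longrightarrow> exec Q s t s' \<Longrightarrow> exec (Cond b P Q) s (1 + bcost b + t) s'"
| WhileFalse: "\<not> bval b s \<Longrightarrow> exec (While b P) s (1 + bcost b) s"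
| WhileTrue: "bval b s \<Longrightarrow> exec P s t s' \<Longrightarrow> exec (While b P) s' u s''
    \<Longrightarrow> exec (While b P) s (1 + bcost b + t + u) s''"


lemma exec_deterministic:
  "exec P s t s' \<Longrightarrow> exec P s u s'' \<Longrightarrow> u = t \<and> s'' = s'"
proof (induction arbitrary: u s'' rule: exec.induct)
  case Skip
  from Skip.prems show ?case by cases simp_all
next
  case NAssign
  from NAssign.prems show ?case by cases simp_all
next
  case WAssign
  from WAssign.prems show ?case by cases simp_all
next
  case (Seq P s t s1 Q v s2)
  note IH = Seq.IH
  from Seq.prems show ?case
  proof cases
    case (Seq t' s1' v')
    with IH show ?thesis by metis
  qed
next
  case IfTrue
  from IfTrue.prems IfTrue.hyps show ?case
    by cases (simp_all add: IfTrue.IH)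
next
  case IfFalse
  from IfFalse.prems IfFalse.hyps show ?case
    by cases (simp_all add: IfFalse.IH)
next
  case WhileFalse
  from WhileFalse.prems WhileFalse.hyps show ?case
    by cases simp_all
next
  case (WhileTrue b s P t s1 v s2)
  note hyps = WhileTrue.hyps and IH = WhileTrue.IH
  from WhileTrue.prems show ?case
  proof cases
    case WhileFalse
    with hyps show ?thesis by simp
  next
    case (WhileTrue t' s1' v')
    with IH show ?thesis by metis
  qed
qed


section \<open>Input encoding\<close>

definition arr :: "'a::zero list \<Rightarrow> nat \<Rightarrow> 'a" where
  "arr xs i = (if i < length xs then xs ! i else 0)"

definition cell_index :: "cbm \<Rightarrow> nat \<Rightarrow> nat" where
  "cell_index I v = (THE i. i \<in> {1..parts I} \<and> v \<in> cell I i)"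

definition input_store ::
  "cbm \<Rightarrow> nat list \<Rightarrow> (nat \<times> nat) list \<Rightarrow> (nat \<times> nat) list \<Rightarrow> store" where
  "input_store I vs es js =
     \<lparr>nmem = (\<lambda>_ _. 0)
        (''n'' := arr [length vs],
         ''m'' := arr [length es],
         ''k'' := arr [parts I],
         ''c'' := arr [length js],
         ''side'' := arr (map (\<lambda>v. if v \<in> V1 I then 1 else 2) vs),
         ''cell'' := arr (map (cell_index I) vs),
         ''left'' := arr (map fst es),
         ''right'' := arr (map snd es),
         ''join1'' := arr (map fst js),
         ''join2'' := arr (map snd js)),
      wmem = (\<lambda>_ _. 0)
        (''wmax'' := arr [ereal (wmax I)],
         ''weight'' := arr (map (\<lambda>(a, b). wt I {vs ! a, vs ! b}) es))\<rparr>"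

text \<open>
  The vertices, edges and joins of an instance may be listed in any order. The program sees
  a vertex only through its position in the vertex list \<open>vs\<close>; an edge is given by the
  position of its endpoint in \<open>V1\<close> followed by that of its endpoint in \<open>V2\<close>.
\<close>

definition represents :: "store \<Rightarrow> cbm \<Rightarrow> bool" where
  "represents s I \<longleftrightarrow>
     (\<exists>vs es js.
        distinct vs \<and> set vs = verts I \<and>
        distinct es \<and>
        set es = {(a, b). a < length vs \<and> b < length vs \<and>
                          vs ! a \<in> V1 I \<and> vs ! b \<in> V2 I \<and> {vs ! a, vs ! b} \<in> E I} \<and>
        distinct js \<and> set js = {(i, j). i < j \<and> {i, j} \<in> joins I} \<and>
        s = input_store I vs es js)"

end

(* Edges are handled as choices of the V1 vertices, each of which has at most two. A perfect matching
   X, if there is one, is found by inserting the V1 vertices one after another; an insertion may evict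
   the previous partner of a V2 vertex, which then has to move to its only alternative. Relative to X
   the graph becomes a function nx on X: from an edge e go to the X-edge that meets the other edge at
   the V1 end of e. The perfect matchings are exactly the sets obtained from X by flipping some of the
   cycles of nx. Each cycle thus contributes one binary choice, and a table indexed by the sets S of joins,
   holding the least weight of a choice that satisfies all joins in S, is updated cycle by cycle.
   This takes time O(n^2 2^c), which is O(n^3) for 2^c <= n and O(n 4^c) otherwise, and
   2c <= c(c+1) when c > 0. *)
theory Submission
  imports Defs
begin

section \<open>Total correctness with time bounds\<close>

text \<open>The degree bound enters twice: it gives at most \<open>2 * n\<close> edges, and it makes
  the alternative \<open>al e\<close> unique, so that alternation relative to \<open>X\<close> is a
  function. The cycles of a function are pairwise disjoint, hence the flips are independent, and an
  edge of \<open>X\<close> that lies on no cycle belongs to every perfect matching. Each vertex lies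
  in exactly one cell, so an edge satisfies at most one join. Its code \<open>pw e\<close> is
  therefore 0 or a power of two, and adding an edge to a table costs one lookup per entry, at the
  index with that bit cleared. The machine has neither multiplication nor bit operations: powers
  come from doubling, and bits are tested with a cyclic counter. Without a perfect matching an
  insertion walk need not end, so every walk gets a fixed number of rounds and is then abandoned; a
  potential relative to an unknown perfect matching shows that the rounds suffice when one exists.
  Vertices without edges are invisible to conditions on edges. Hence \<open>pm\<close> speaks only
  of ends of edges, and a separate coverage test decides whether all vertices are matched.\<close>

definition ok :: "com \<Rightarrow> store \<Rightarrow> nat \<Rightarrow> (store \<Rightarrow> bool) \<Rightarrow> bool" where
  "ok P s b Q \<longleftrightarrow> (\<exists>t s'. exec P s t s' \<and> t \<le> b \<and> Q s')"

primrec nmods :: "com \<Rightarrow> string set" where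
  "nmods Skip = {}"
| "nmods (NAssign x a e) = {x}"
| "nmods (WAssign x a e) = {}"
| "nmods (Seq P Q) = nmods P \<union> nmods Q"
| "nmods (Cond b P Q) = nmods P \<union> nmods Q"
| "nmods (While b P) = nmods P"

primrec wmods :: "com \<Rightarrow> string set" where
  "wmods Skip = {}"
| "wmods (NAssign x a e) = {}"
| "wmods (WAssign x a e) = {x}"
| "wmods (Seq P Q) = wmods P \<union> wmods Q"
| "wmods (Cond b P Q) = wmods P \<union> wmods Q"
| "wmods (While b P) = wmods P"

definition agree_off :: "string set \<Rightarrow> string set \<Rightarrow> store \<Rightarrow> store \<Rightarrow> bool" where
  "agree_off X Z s s' \<longleftrightarrow>
     (\<forall>y. y \<notin> X \<longrightarrow> nmem s' y = nmem s y) \<and> (\<forall>y. y \<notin> Z \<longrightarrow> wmem s' y = wmem s y)"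

lemma agree_off_nmem: "agree_off X Z s s' \<Longrightarrow> y \<notin> X \<Longrightarrow> nmem s' y = nmem s y"
  and agree_off_wmem: "agree_off X Z s s' \<Longrightarrow> y \<notin> Z \<Longrightarrow> wmem s' y = wmem s y"
  by (auto simp: agree_off_def)

lemma agree_off_trans:
  "agree_off X Z s s' \<Longrightarrow> agree_off X' Z' s' s'' \<Longrightarrow> X \<union> X' \<subseteq> Y \<Longrightarrow> Z \<union> Z' \<subseteq> U \<Longrightarrow>
   agree_off Y U s s''"
  unfolding agree_off_def by (metis UnI1 UnI2 subsetD)

lemma nmem_nupd [simp]:
  "nmem (nupd x i k s) y = (if y = x then (nmem s x)(i := k) else nmem s y)"
  "wmem (nupd x i k s) = wmem s"
  by (auto simp: nupd_def)

lemma wmem_wupd [simp]: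
  "wmem (wupd x i k s) y = (if y = x then (wmem s x)(i := k) else wmem s y)"
  "nmem (wupd x i k s) = nmem s"
  by (auto simp: wupd_def)

lemma exec_agree_off: "exec P s t s' \<Longrightarrow> agree_off (nmods P) (wmods P) s s'"
proof (induction rule: exec.induct)
  case (Seq P s t s' Q u s'')
  then show ?case by (auto intro: agree_off_trans)
next
  case (WhileTrue b s P t s' u s'')
  then show ?case by (auto intro: agree_off_trans)
qed (auto simp: agree_off_def)

lemma ok_mono: "ok P s b Q \<Longrightarrow> b \<le> b' \<Longrightarrow> (\<And>s'. Q s' \<Longrightarrow> Q' s') \<Longrightarrow> ok P s b' Q'"
  unfolding ok_def by (meson le_trans)

lemma ok_frame:
  assumes "ok P s b Q" "b \<le> b'"
    "\<And>s'. Q s' \<Longrightarrow> agree_off (nmods P) (wmods P) s s' \<Longrightarrow> Q' s'"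
  shows "ok P s b' Q'"
  using assms exec_agree_off unfolding ok_def by (meson le_trans)

lemma ok_Seq:
  assumes "ok P s bP A"
    "\<And>s1. A s1 \<Longrightarrow> agree_off (nmods P) (wmods P) s s1 \<Longrightarrow> ok Q s1 bQ R" "bP + bQ \<le> b"
  shows "ok (Seq P Q) s b R"
proof -
  obtain t s1 where 1: "exec P s t s1" "t \<le> bP" "A s1"
    using assms(1) unfolding ok_def by blast
  obtain u s2 where 2: "exec Q s1 u s2" "u \<le> bQ" "R s2"
    using assms(2)[OF 1(3) exec_agree_off[OF 1(1)]] unfolding ok_def by blast
  have "exec (Seq P Q) s (t + u) s2" using 1 2 by (blast intro: exec.Seq)
  moreover have "t + u \<le> b" using 1 2 assms(3) by linarith
  ultimately show ?thesis using 2 unfolding ok_def by blast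
qed

lemma ok_Cond:
  assumes "bval c s \<Longrightarrow> ok P s bP R" "\<not> bval c s \<Longrightarrow> ok Q s bP R" "1 + bcost c + bP \<le> b"
  shows "ok (Cond c P Q) s b R"
proof (cases "bval c s")
  case True
  then obtain t s1 where "exec P s t s1" "t \<le> bP" "R s1"
    using assms(1) unfolding ok_def by blast
  with True assms(3) show ?thesis unfolding ok_def
    by (intro exI[of _ "1 + bcost c + t"] exI[of _ s1]) (auto intro: exec.IfTrue[simplified])
next
  case False
  then obtain t s1 where "exec Q s t s1" "t \<le> bP" "R s1"
    using assms(2) unfolding ok_def by blast
  with False assms(3) show ?thesis unfolding ok_def
    by (intro exI[of _ "1 + bcost c + t"] exI[of _ s1]) (auto intro: exec.IfFalse[simplified])
qed

primrec loop_free :: "com \<Rightarrow> bool" where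
  "loop_free Skip = True"
| "loop_free (NAssign x a e) = True"
| "loop_free (WAssign x a e) = True"
| "loop_free (Seq P Q) = (loop_free P \<and> loop_free Q)"
| "loop_free (Cond b P Q) = (loop_free P \<and> loop_free Q)"
| "loop_free (While b P) = False"

text \<open>Symbolic execution of straight-line code. The clause for \<open>While\<close> is a dummy
  value, excluded by \<open>loop_free\<close> in \<open>ok_run\<close>.\<close>

primrec run :: "com \<Rightarrow> store \<Rightarrow> store" where
  "run Skip s = s"
| "run (NAssign x a e) s = nupd x (nval a s) (nval e s) s"
| "run (WAssign x a e) s = wupd x (nval a s) (wval e s) s"
| "run (Seq P Q) s = run Q (run P s)"
| "run (Cond b P Q) s = (if bval b s then run P s else run Q s)"
| "run (While b P) s = s"

text \<open>Charging both branches of a conditional makes the bound independent of the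
  store.\<close>

primrec max_cost :: "com \<Rightarrow> nat" where
  "max_cost Skip = 1"
| "max_cost (NAssign x a e) = 1 + ncost a + ncost e"
| "max_cost (WAssign x a e) = 1 + ncost a + wcost e"
| "max_cost (Seq P Q) = max_cost P + max_cost Q"
| "max_cost (Cond b P Q) = 1 + bcost b + max_cost P + max_cost Q"
| "max_cost (While b P) = 0"

lemma ok_run:
  "loop_free P \<Longrightarrow> max_cost P \<le> b \<Longrightarrow> Q (run P s) \<Longrightarrow> ok P s b Q"
proof (induction P arbitrary: s b Q)
  case Skip
  then show ?case unfolding ok_def using exec.Skip[of s] by auto
next
  case (NAssign x a e)
  then show ?case unfolding ok_def by (auto intro: exec.NAssign[simplified])
next
  case (WAssign x a e)
  then show ?case unfolding ok_def by (auto intro: exec.WAssign[simplified])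
next
  case (Seq P1 P2)
  have "ok P1 s (max_cost P1) (\<lambda>s1. s1 = run P1 s)"
    using Seq by (intro Seq.IH(1)) auto
  then show ?case
    by (rule ok_Seq[where bQ = "max_cost P2"]) (use Seq in auto)
next
  case (Cond c P1 P2)
  show ?case
    by (rule ok_Cond[where bP = "max_cost P1 + max_cost P2"]) (use Cond in auto)
qed auto

lemma ok_Seq_run:
  assumes "loop_free P" "max_cost P + bQ \<le> b" "ok Q (run P s) bQ R"
  shows "ok (Seq P Q) s b R"
proof (rule ok_Seq[where bQ = bQ])
  show "ok P s (max_cost P) (\<lambda>s1. s1 = run P s)" by (rule ok_run) (use assms in auto)
qed (use assms in auto)

subsection \<open>Counting loops\<close>

abbreviation Var :: "string \<Rightarrow> nexp" where
  "Var x \<equiv> NRead x (NConst 0)"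

abbreviation NSet :: "string \<Rightarrow> nexp \<Rightarrow> com" where
  "NSet x e \<equiv> NAssign x (NConst 0) e"

definition NEq :: "nexp \<Rightarrow> nexp \<Rightarrow> bexp" where
  "NEq a b = BAnd (NLe a b) (NLe b a)"

definition BOr :: "bexp \<Rightarrow> bexp \<Rightarrow> bexp" where
  "BOr a b = BNot (BAnd (BNot a) (BNot b))"

lemma bval_NEq [simp]: "bval (NEq a b) s \<longleftrightarrow> nval a s = nval b s"
  and bcost_NEq [simp]: "bcost (NEq a b) = 3 + 2 * ncost a + 2 * ncost b"
  by (auto simp: NEq_def)

lemma bval_BOr [simp]: "bval (BOr a b) s \<longleftrightarrow> bval a s \<or> bval b s"
  and bcost_BOr [simp]: "bcost (BOr a b) = 4 + bcost a + bcost b"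
  by (auto simp: BOr_def)

definition For_while :: "string \<Rightarrow> string \<Rightarrow> com \<Rightarrow> com" where
  "For_while x l P = While (BNot (NLe (Var l) (Var x))) (Seq P (NSet x (NAdd (Var x) (NConst 1))))"

definition For :: "string \<Rightarrow> string \<Rightarrow> com \<Rightarrow> com" where
  "For x l P = Seq (NSet x (NConst 0)) (For_while x l P)"

lemma mods_For [simp]:
  "nmods (For x l P) = insert x (nmods P)" "wmods (For x l P) = wmods P" "\<not> loop_free (For x l P)"
  by (auto simp: For_def For_while_def)

text \<open>Induction on the number \<open>k\<close> of rounds still to come. The invariant is
  demanded after the increment, so it may mention the counter. A round costs \<open>B\<close>, plus
  7 for the test and 6 for the increment; the final 7 pays for the failing test.\<close>

lemma ok_For_while:
  assumes x: "x \<notin> nmods P" "l \<notin> nmods P" "x \<noteq> l"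
    and step: "\<And>i s1. i < nmem s l 0 \<Longrightarrow> agree_off (insert x (nmods P)) (wmods P) s s1 \<Longrightarrow>
      nmem s1 x 0 = i \<Longrightarrow> Inv i s1 \<Longrightarrow> ok P s1 B (\<lambda>s2. Inv (Suc i) (nupd x 0 (Suc i) s2))"
  shows "k \<le> nmem s l 0 \<Longrightarrow> i = nmem s l 0 - k \<Longrightarrow> agree_off (insert x (nmods P)) (wmods P) s s1 \<Longrightarrow>
      nmem s1 x 0 = i \<Longrightarrow> Inv i s1 \<Longrightarrow>
      ok (For_while x l P) s1 (k * (B + 13) + 7)
        (\<lambda>s'. Inv (nmem s l 0) s' \<and> agree_off (insert x (nmods P)) (wmods P) s s')"
proof (induction k arbitrary: i s1)
  case 0
  let ?b = "BNot (NLe (Var l) (Var x))"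
  have "nmem s1 l = nmem s l" using 0 x by (auto dest: agree_off_nmem)
  then have "\<not> bval ?b s1" using 0 by simp
  from exec.WhileFalse[OF this] show ?case unfolding ok_def For_while_def using 0
    by fastforce
next
  case (Suc k)
  let ?b = "BNot (NLe (Var l) (Var x))" and ?n = "nmem s l 0"
  let ?inc = "NSet x (NAdd (Var x) (NConst 1))"
  have l: "nmem s1 l = nmem s l" using Suc.prems x by (auto dest: agree_off_nmem)
  then have b: "bval ?b s1" and i: "i < ?n" using Suc.prems by auto
  obtain t s2 where 1: "exec P s1 t s2" "t \<le> B" "Inv (Suc i) (nupd x 0 (Suc i) s2)"
    using step[OF i Suc.prems(3-5)] unfolding ok_def by blast
  have fr: "agree_off (nmods P) (wmods P) s1 s2" using 1(1) by (rule exec_agree_off)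
  then have "nmem s2 x 0 = i" using x Suc.prems by (auto dest: agree_off_nmem)
  then have 2: "exec ?inc s2 6 (nupd x 0 (Suc i) s2)"
    using exec.NAssign[of x "NConst 0" "NAdd (Var x) (NConst 1)" s2] by (simp add: eval_nat_numeral)
  have "agree_off (insert x (nmods P)) (wmods P) s (nupd x 0 (Suc i) s2)"
    using Suc.prems(3) fr by (auto simp: agree_off_def)
  then obtain u s3 where 3: "exec (For_while x l P) (nupd x 0 (Suc i) s2) u s3"
     "u \<le> k * (B + 13) + 7" "Inv ?n s3" "agree_off (insert x (nmods P)) (wmods P) s s3"
    using Suc.IH[of "Suc i" "nupd x 0 (Suc i) s2"] 1(3) Suc.prems(1,2) i unfolding ok_def by fastforce
  have "exec (For_while x l P) s1 (1 + bcost ?b + (t + 6) + u) s3"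
    unfolding For_while_def
    by (rule exec.WhileTrue[OF b exec.Seq[OF 1(1) 2]]) (use 3(1) in \<open>simp add: For_while_def\<close>)
  moreover have "1 + bcost ?b + (t + 6) + u \<le> Suc k * (B + 13) + 7"
    using 1(2) 3(2) by simp
  ultimately show ?case using 3 unfolding ok_def by blast
qed

text \<open>The body changes neither counter nor limit, so exactly \<open>N\<close> rounds are made.
  The slack of 20 in \<open>C\<close> covers the 13 units of overhead per round, and one further
  \<open>C\<close> pays for the initialisation and the last test.\<close>

lemma ok_For:
  assumes x: "x \<notin> nmods P" "l \<notin> nmods P" "x \<noteq> l" and N: "nmem s l 0 = N"
    and init: "Inv 0 (nupd x 0 0 s)"
    and step: "\<And>i s1. i < N \<Longrightarrow> agree_off (insert x (nmods P)) (wmods P) s s1 \<Longrightarrow>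
      nmem s1 x 0 = i \<Longrightarrow> Inv i s1 \<Longrightarrow> ok P s1 B (\<lambda>s2. Inv (Suc i) (nupd x 0 (Suc i) s2))"
    and time: "B + 20 \<le> C" "(N + 1) * C \<le> b"
    and post: "\<And>s'. agree_off (insert x (nmods P)) (wmods P) s s' \<Longrightarrow> Inv N s' \<Longrightarrow> Q s'"
  shows "ok (For x l P) s b Q"
  unfolding For_def
proof (rule ok_Seq[where bQ = "N * (B + 13) + 7"])
  show "ok (NSet x (NConst 0)) s 3 (\<lambda>s1. s1 = nupd x 0 0 s)"
    by (rule ok_run) auto
  have "N * (B + 13) \<le> N * C" using time by (intro mult_le_mono) auto
  moreover have "N * C + C \<le> b" using time by simp
  ultimately show "3 + (N * (B + 13) + 7) \<le> b" using time by linarith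
next
  fix s1 assume s1: "s1 = nupd x 0 0 s"
  show "ok (For_while x l P) s1 (N * (B + 13) + 7) Q"
    by (rule ok_mono[OF ok_For_while[where s = s and i = 0 and k = N and Inv = Inv, OF x step[folded N]]])
      (use s1 init N in \<open>auto simp: agree_off_def intro: post\<close>)
qed

section \<open>Bipartite graphs of degree at most two on the left\<close>

text \<open>
  Edges are numbered from 1, so that 0 can stand for \<open>no edge\<close>. The edge \<open>al e\<close> is the other edge
  at the left end of \<open>e\<close>, or \<open>e\<close> itself if there is none.
\<close>

locale two_choice =
  fixes Ed :: "nat set" and L R al :: "nat \<Rightarrow> nat"
  assumes fin: "finite Ed" and zero: "0 \<notin> Ed" "al 0 = 0"
    and al: "e \<in> Ed \<Longrightarrow> al e \<in> Ed" "e \<in> Ed \<Longrightarrow> L (al e) = L e"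
    and two: "e \<in> Ed \<Longrightarrow> e' \<in> Ed \<Longrightarrow> L e' = L e \<Longrightarrow> e' = e \<or> e' = al e"
begin

text \<open>Perfect only with respect to vertices that are ends of edges; isolated vertices are the
  business of \<open>perf_iff\<close>.\<close>

definition pm :: "nat set \<Rightarrow> bool" where
  "pm Y \<longleftrightarrow> Y \<subseteq> Ed \<and> inj_on L Y \<and> inj_on R Y \<and> L ` Y = L ` Ed \<and> R ` Y = R ` Ed"

lemma pm_choice: "pm Y \<Longrightarrow> e \<in> Ed \<Longrightarrow> e \<in> Y \<or> al e \<in> Y"
  unfolding pm_def by (smt (verit) image_iff subsetD two)

lemma pm_L: "pm Y \<Longrightarrow> e \<in> Y \<Longrightarrow> e' \<in> Y \<Longrightarrow> L e = L e' \<Longrightarrow> e = e'"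
  and pm_R: "pm Y \<Longrightarrow> e \<in> Y \<Longrightarrow> e' \<in> Y \<Longrightarrow> R e = R e' \<Longrightarrow> e = e'"
  unfolding pm_def by (auto dest: inj_onD)

subsection \<open>Insertion with evictions\<close>

text \<open>
  \<open>own b\<close> is the edge assigned to the right vertex \<open>b\<close>, or 0; \<open>D\<close> is the set of left vertices inserted
  so far; \<open>cur\<close> is the edge about to be assigned, or 0 when the walk has ended.
\<close>

definition held :: "(nat \<Rightarrow> nat) \<Rightarrow> nat set" where
  "held own = {e \<in> Ed. own (R e) = e}"

definition ins_inv :: "(nat \<Rightarrow> nat) \<Rightarrow> nat set \<Rightarrow> nat \<Rightarrow> bool" where
  "ins_inv own D cur \<longleftrightarrow>
     (\<forall>b. own b \<noteq> 0 \<longrightarrow> own b \<in> Ed \<and> R (own b) = b) \<and> inj_on L (held own) \<and>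
     L ` held own = (if cur = 0 then D else D - {L cur}) \<and>
     (cur \<noteq> 0 \<longrightarrow> cur \<in> Ed \<and> L cur \<in> D)"

text \<open>A right vertex holds one edge, so at most one edge is displaced. If the vertex was free,
  the entry is 0, which is no edge, and the difference removes nothing.\<close>

lemma held_step:
  assumes "ins_inv own D cur" "cur \<noteq> 0"
  shows "held (own(R cur := cur)) = insert cur (held own - {own (R cur)})"
proof -
  have "R e = R cur" if "e = own (R cur)" "e \<in> Ed" for e
    using that assms zero unfolding ins_inv_def by metis
  then show ?thesis using assms unfolding held_def ins_inv_def by (auto; metis)
qed

text \<open>An evicted edge leaves its left end as the only uncovered vertex of \<open>D\<close>,
  and its alternative starts at that same vertex. If nothing is evicted, \<open>al 0 = 0\<close>
  ends the walk.\<close>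

lemma ins_inv_step:
  assumes i: "ins_inv own D cur" and cur: "cur \<noteq> 0"
  shows "ins_inv (own(R cur := cur)) D (al (own (R cur)))"
proof -
  let ?o = "own (R cur)"
  note h = held_step[OF i cur]
  have c: "cur \<in> Ed" "L cur \<in> D" "L cur \<notin> L ` held own"
    using i cur unfolding ins_inv_def by auto
  have D: "L ` held own = D - {L cur}" and inj: "inj_on L (held own)"
    using i cur unfolding ins_inv_def by auto
  have pl: "\<forall>b. (own(R cur := cur)) b \<noteq> 0 \<longrightarrow>
      (own(R cur := cur)) b \<in> Ed \<and> R ((own(R cur := cur)) b) = b"
    using i c(1) unfolding ins_inv_def by (metis fun_upd_apply)
  have inj': "inj_on L (held (own(R cur := cur)))"
    unfolding h using c(3) inj_on_subset[OF inj Diff_subset] by (auto simp only: inj_on_insert)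
  show ?thesis
  proof (cases "?o = 0")
    case True
    then have "held own - {?o} = held own" using zero by (auto simp: held_def)
    then have "L ` held (own(R cur := cur)) = D" using D c unfolding h by auto
    then show ?thesis unfolding ins_inv_def using True inj' pl zero by simp
  next
    case False
    then have o: "?o \<in> Ed" "R ?o = R cur" using i unfolding ins_inv_def by auto
    then have oh: "?o \<in> held own" by (simp add: held_def)
    have "L ` (held own - {?o}) = L ` held own - {L ?o}"
      using inj_on_image_set_diff[OF inj Diff_subset, of "{?o}"] oh by simp
    moreover have "L ?o \<noteq> L cur" "L ?o \<in> D" using imageI[OF oh, of L] unfolding D by auto
    ultimately have "L ` insert cur (held own - {?o}) = insert (L cur) (D - {L cur} - {L ?o})"
      using D by (simp only: image_insert)
    also have "\<dots> = D - {L ?o}" using c(2) \<open>L ?o \<noteq> L cur\<close> by blast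
    finally have "L ` insert cur (held own - {?o}) = D - {L (al ?o)}"
      using al(2)[OF o(1)] by simp
    moreover have "al ?o \<noteq> 0" using al(1)[OF o(1)] zero by metis
    ultimately show ?thesis using inj' pl al[OF o(1)] \<open>L ?o \<in> D\<close> unfolding ins_inv_def h by simp
  qed
qed

lemma ins_inv_start:
  "ins_inv own D 0 \<Longrightarrow> e \<in> Ed \<Longrightarrow> L e \<notin> D \<Longrightarrow> ins_inv own (insert (L e) D) e"
  using zero unfolding ins_inv_def by auto

text \<open>Serves to abandon a walk that has used up its rounds: the one left vertex still waiting
  is withdrawn from \<open>D\<close>.\<close>

lemma ins_inv_stop: "ins_inv own D cur \<Longrightarrow> cur \<noteq> 0 \<Longrightarrow> ins_inv own (D - {L cur}) 0"
  unfolding ins_inv_def by auto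

text \<open>
  Compare the matching built so far with a perfect matching \<open>Y\<close>. Once the walk moves into an edge of
  \<open>Y\<close> it does so forever and the agreement with \<open>Y\<close> grows at every step; until then the
  agreement shrinks at every step. In both phases the following quantity decreases.
\<close>

definition potential :: "nat set \<Rightarrow> (nat \<Rightarrow> nat) \<Rightarrow> nat \<Rightarrow> nat" where
  "potential Y own cur =
     (if cur \<in> Y then card Y - card (held own \<inter> Y) else card Y + card (held own \<inter> Y) + 1)"

lemma potential_step:
  assumes Y: "pm Y" and i: "ins_inv own D cur" and cur: "cur \<noteq> 0" and o: "own (R cur) \<noteq> 0"
  shows "potential Y (own(R cur := cur)) (al (own (R cur))) < potential Y own cur"
proof -
  let ?o = "own (R cur)" and ?H = "held own"
  have YE: "Y \<subseteq> Ed" and fY: "finite Y" using Y fin unfolding pm_def by (auto intro: finite_subset)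
  have c: "cur \<in> Ed" "cur \<notin> ?H" using i cur unfolding ins_inv_def by auto
  have oE: "?o \<in> Ed" "R ?o = R cur" using i o unfolding ins_inv_def by auto
  then have oh: "?o \<in> ?H" by (simp add: held_def)
  have ne: "?o \<noteq> cur" using oh c by auto
  have fH: "finite (?H \<inter> Y)" using fY by auto
  have le: "card (?H \<inter> Y) \<le> card Y" using fY by (auto intro: card_mono)
  note h = held_step[OF i cur]
  show ?thesis
  proof (cases "cur \<in> Y")
    case True
    \<comment> \<open>The evicted edge shares its right end with \<open>cur\<close>, which is in
      \<open>Y\<close>. So the walk stays in the phase inside \<open>Y\<close>.\<close>
    have "?o \<notin> Y" using pm_R[OF Y _ True] oE ne by auto
    then have "al ?o \<in> Y" using pm_choice[OF Y oE(1)] by auto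
    moreover have "insert cur (?H - {?o}) \<inter> Y = insert cur (?H \<inter> Y)"
      using True \<open>?o \<notin> Y\<close> by auto
    moreover have "card (insert cur (?H \<inter> Y)) = Suc (card (?H \<inter> Y))"
      using fH c by auto
    \<comment> \<open>Guarantees a strict decrease: without it the truncated difference could
      already be 0.\<close>
    moreover have "card (insert cur (?H \<inter> Y)) \<le> card Y" using fY True by (auto intro: card_mono)
    ultimately show ?thesis using True unfolding potential_def h by auto
  next
    case False
    show ?thesis
    proof (cases "?o \<in> Y")
      case True
      have eq: "insert cur (?H - {?o}) \<inter> Y = (?H \<inter> Y) - {?o}" using False by auto
      have "card (?H \<inter> Y) > 0" using True oh fH by (auto simp: card_gt_0_iff)
      moreover have "card ((?H \<inter> Y) - {?o}) = card (?H \<inter> Y) - 1"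
        using True oh by (intro card_Diff_singleton) auto
      ultimately show ?thesis using False unfolding potential_def h eq by auto
    next
      \<comment> \<open>The walk enters \<open>Y\<close> here while the agreement with
        \<open>Y\<close> is unchanged; the \<open>+ 1\<close> in \<open>potential\<close> makes this
        a decrease even if that agreement is empty.\<close>
      case oY: False
      then have "al ?o \<in> Y" using pm_choice[OF Y oE(1)] by auto
      then show ?thesis using False unfolding potential_def by auto
    qed
  qed
qed

lemma potential_le: "pm Y \<Longrightarrow> potential Y own cur \<le> 2 * card Ed + 1"
proof -
  assume Y: "pm Y"
  then have fY: "finite Y" and "card Y \<le> card Ed"
    using fin unfolding pm_def by (auto intro: finite_subset card_mono)
  moreover have "card (held own \<inter> Y) \<le> card Y" using fY by (auto intro: card_mono)
  ultimately show ?thesis unfolding potential_def by auto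
qed

lemma held_subset: "held own \<subseteq> Ed"
  by (auto simp: held_def)

lemma inj_on_R_held: "inj_on R (held own)"
proof (rule inj_onI)
  fix e e' assume "e \<in> held own" "e' \<in> held own" and R: "R e = R e'"
  then have "own (R e) = e" "own (R e') = e'" by (simp_all add: held_def)
  then show "e = e'" using R by metis
qed

lemma held_pm:
  assumes "ins_inv own D 0" "L ` Ed \<subseteq> L ` held own" "R ` Ed \<subseteq> R ` held own"
  shows "pm (held own)"
proof -
  have "L ` held own = L ` Ed" "R ` held own = R ` Ed"
    using assms(2,3) held_subset[of own] by blast+
  then show ?thesis
    using assms(1) held_subset[of own] inj_on_R_held[of own] unfolding pm_def ins_inv_def by blast
qed

text \<open>A counting argument: the held edges are as many as the left ends, hence as many as the
  edges of \<open>Y\<close>, hence as many as the right ends.\<close>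

lemma held_covers_R:
  assumes "ins_inv own D 0" "L ` Ed \<subseteq> D" "pm Y"
  shows "R ` held own = R ` Ed"
proof (rule card_subset_eq)
  show "finite (R ` Ed)" using fin by auto
  show "R ` held own \<subseteq> R ` Ed" by (auto simp: held_def)
  have inj: "inj_on L (held own)" using assms unfolding ins_inv_def by auto
  have "card (R ` held own) = card (L ` held own)" using inj inj_on_R_held by (simp add: card_image)
  also have "L ` held own = L ` Ed" using assms unfolding ins_inv_def by (auto simp: held_def)
  also have "card (L ` Ed) = card Y" using assms(3) unfolding pm_def by (metis card_image)
  also have "\<dots> = card (R ` Ed)" using assms(3) unfolding pm_def by (metis card_image)
  finally show "card (R ` held own) = card (R ` Ed)" .
qed

end

subsection \<open>Flipping cycles\<close>

locale flips = two_choice +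
  fixes X :: "nat set" and nx :: "nat \<Rightarrow> nat"
  assumes X: "pm X"
    and nx: "e \<in> X \<Longrightarrow> nx e \<in> X" "e \<in> X \<Longrightarrow> R (nx e) = R (al e)"
begin

definition cyclic :: "nat \<Rightarrow> bool" where
  "cyclic x \<longleftrightarrow> (\<exists>k>0. (nx ^^ k) x = x)"

text \<open>Being closed under \<open>nx\<close> and made of cyclic edges, \<open>F\<close> is a
  union of whole cycles. An edge without alternative is a fixed point of \<open>nx\<close>, and
  flipping it changes nothing.\<close>

definition fam :: "nat set \<Rightarrow> nat set set" where
  "fam V = {(V - F) \<union> al ` F | F. F \<subseteq> V \<and> (\<forall>x\<in>F. cyclic x) \<and> nx ` F \<subseteq> F}"

text \<open>Only cycles must be included as wholes; the successor of an acyclic edge may be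
  missing.\<close>

definition cyc_closed :: "nat set \<Rightarrow> bool" where
  "cyc_closed V \<longleftrightarrow> V \<subseteq> X \<and> (\<forall>x\<in>V. cyclic x \<longrightarrow> nx x \<in> V)"

lemma XE: "X \<subseteq> Ed" and finX: "finite X"
  using X fin unfolding pm_def by (auto intro: finite_subset)

lemma funpow_X: "x \<in> X \<Longrightarrow> (nx ^^ i) x \<in> X"
  by (induction i) (auto simp: nx)

lemma funpow_mem: "nx ` F \<subseteq> F \<Longrightarrow> x \<in> F \<Longrightarrow> (nx ^^ i) x \<in> F"
  by (induction i) auto

lemma cyclic_nx: "cyclic x \<Longrightarrow> cyclic (nx x)"
  unfolding cyclic_def by (metis funpow_swap1)

lemma cyclic_funpow: "cyclic x \<Longrightarrow> cyclic ((nx ^^ i) x)"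
  by (induction i) (auto simp: cyclic_nx)

lemma funpow_period: "(nx ^^ p) x = x \<Longrightarrow> (nx ^^ (p * k)) x = x"
  by (induction k) (auto simp: funpow_add)

lemma orbit_back:
  assumes "(nx ^^ p) x = x" "p > 0"
  shows "\<exists>j. (nx ^^ j) ((nx ^^ i) x) = x"
proof -
  \<comment> \<open>\<open>p * i\<close> is a multiple of the period that is at least
    \<open>i\<close>; the remaining \<open>p * i - i\<close> steps lead back to
    \<open>x\<close>.\<close>
  have "i \<le> p * i" using assms(2) by simp
  then have "(nx ^^ (p * i - i)) ((nx ^^ i) x) = (nx ^^ (p * i)) x"
    by (metis add_diff_inverse_nat add.commute comp_apply funpow_add not_less)
  then show ?thesis using funpow_period[OF assms(1)] by auto
qed

text \<open>Both points return after \<open>p * q\<close> steps, a common multiple of their periods,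
  and their orbits agree from the first step on.\<close>

lemma nx_inj_cyclic:
  assumes "cyclic x" "cyclic y" "nx x = nx y" shows "x = y"
proof -
  obtain p q where p: "p > 0" "(nx ^^ p) x = x" and q: "q > 0" "(nx ^^ q) y = y"
    using assms unfolding cyclic_def by auto
  obtain k where k: "p * q = Suc k" using p q by (metis gr0_implies_Suc nat_0_less_mult_iff)
  have "x = (nx ^^ Suc k) x" using funpow_period[OF p(2), of q] k by simp
  also have "\<dots> = (nx ^^ k) (nx y)" using assms(3) by (simp add: funpow_swap1)
  also have "\<dots> = (nx ^^ (q * p)) y" using k by (simp add: funpow_swap1 mult.commute)
  also have "\<dots> = y" by (rule funpow_period[OF q(2)])
  finally show ?thesis .
qed

text \<open>By finiteness the orbit repeats itself; injectivity on \<open>F\<close> cancels the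
  common initial steps, so the repetition already happens at \<open>x\<close>.\<close>

lemma cyclic_if_inj_on:
  assumes F: "finite F" "nx ` F \<subseteq> F" "inj_on nx F" and x: "x \<in> F"
  shows "cyclic x"
proof -
  have "\<not> inj (\<lambda>i. (nx ^^ i) x)"
  proof
    assume "inj (\<lambda>i. (nx ^^ i) x)"
    moreover have "range (\<lambda>i. (nx ^^ i) x) \<subseteq> F" using funpow_mem[OF F(2) x] by auto
    ultimately show False using F(1) by (meson finite_subset infinite_UNIV_nat finite_imageD)
  qed
  then obtain i j where ij: "i < j" "(nx ^^ i) x = (nx ^^ j) x"
    unfolding inj_def by (metis linorder_neqE_nat)
  have "(nx ^^ i) y = (nx ^^ i) z \<Longrightarrow> y \<in> F \<Longrightarrow> z \<in> F \<Longrightarrow> y = z" for y z i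
    using funpow_mem[OF F(2)] F(3) by (induction i) (auto dest: inj_onD)
  moreover have "(nx ^^ i) ((nx ^^ (j - i)) x) = (nx ^^ i) x"
    using ij by (metis add_diff_inverse_nat comp_apply funpow_add less_imp_not_less)
  ultimately have "(nx ^^ (j - i)) x = x" using funpow_mem[OF F(2) x] x by blast
  then show ?thesis using ij unfolding cyclic_def by (intro exI[of _ "j - i"]) auto
qed

text \<open>Take the least period \<open>p\<close>. If steps \<open>i < j < p\<close> led to the
  same point, \<open>p - j + i\<close> would be a smaller period; so the orbit has \<open>p\<close>
  distinct members, all in \<open>X\<close>.\<close>

lemma period_le:
  assumes x: "x \<in> X" "cyclic x"
  shows "\<exists>p. 0 < p \<and> p \<le> card X \<and> (nx ^^ p) x = x \<and> inj_on (\<lambda>i. (nx ^^ i) x) {..<p}"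
proof -
  define p where "p = (LEAST k. 0 < k \<and> (nx ^^ k) x = x)"
  have p: "0 < p" "(nx ^^ p) x = x" 
    using LeastI_ex[of "\<lambda>k. 0 < k \<and> (nx ^^ k) x = x"] x(2) unfolding cyclic_def p_def by auto
  have least: "p \<le> k" if "0 < k" "(nx ^^ k) x = x" for k
    unfolding p_def using that by (intro Least_le) auto
  have "(nx ^^ i) x \<noteq> (nx ^^ j) x" if "i < j" "j < p" for i j
  proof
    assume eq: "(nx ^^ i) x = (nx ^^ j) x"
    have "(nx ^^ (p - j + i)) x = (nx ^^ (p - j)) ((nx ^^ j) x)" using eq by (simp add: funpow_add)
    also have "\<dots> = (nx ^^ p) x" using that
      by (metis add.commute add_diff_inverse_nat comp_apply funpow_add less_imp_not_less)
    finally have "p \<le> p - j + i" using that p by (intro least) auto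
    with that show False by linarith
  qed
  then have inj: "inj_on (\<lambda>i. (nx ^^ i) x) {..<p}"
    unfolding inj_on_def by (metis lessThan_iff linorder_neqE_nat)
  have "card ((\<lambda>i. (nx ^^ i) x) ` {..<p}) \<le> card X"
    using funpow_X[OF x(1)] finX by (intro card_mono) auto
  then show ?thesis using p inj by (auto simp: card_image)
qed

lemma fam_empty: "fam {} = {{}}"
  by (auto simp: fam_def)

lemma fam_mem:
  assumes "V \<subseteq> X" "Y \<in> fam V"
  shows "Y \<subseteq> Ed" "finite Y" "L ` Y \<subseteq> L ` V"
proof -
  obtain F where F: "Y = (V - F) \<union> al ` F" "F \<subseteq> V" using assms(2) unfolding fam_def by auto
  show E: "Y \<subseteq> Ed" using F assms XE al by auto
  then show "finite Y" using fin by (rule finite_subset)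
  have "L (al x) = L x" if "x \<in> F" for x using that F assms XE al by blast
  then show "L ` Y \<subseteq> L ` V" using F by auto
qed

text \<open>Flipping preserves left ends, and distinct edges of \<open>X\<close> have distinct left
  ends.\<close>

lemma fam_fresh:
  assumes "V \<subseteq> X" "Y \<in> fam V" "f \<in> X" "f \<notin> V"
  shows "L f \<notin> L ` Y"
  using fam_mem(3)[OF assms(1,2)] assms pm_L[OF X] by (auto simp: subset_iff image_iff)

lemma fam_acyclic:
  assumes V: "cyc_closed V" and x: "x \<in> X" "x \<notin> V" "\<not> cyclic x"
  shows "cyc_closed (insert x V)" "fam (insert x V) = insert x ` fam V"
proof -
  show "cyc_closed (insert x V)" using assms unfolding cyc_closed_def by auto
  show "fam (insert x V) = insert x ` fam V"
  proof (intro equalityI subsetI)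
    fix Y assume "Y \<in> fam (insert x V)"
    then obtain F where F: "Y = (insert x V - F) \<union> al ` F" "F \<subseteq> insert x V" "\<forall>x\<in>F. cyclic x"
      "nx ` F \<subseteq> F" unfolding fam_def by auto
    have "x \<notin> F" using F x by auto
    then have "Y = insert x ((V - F) \<union> al ` F)" "F \<subseteq> V" using F by auto
    then show "Y \<in> insert x ` fam V" using F unfolding fam_def by blast
  next
    fix Y assume "Y \<in> insert x ` fam V"
    then obtain F where F: "Y = insert x ((V - F) \<union> al ` F)" "F \<subseteq> V" "\<forall>x\<in>F. cyclic x"
      "nx ` F \<subseteq> F" unfolding fam_def by auto
    then have "Y = (insert x V - F) \<union> al ` F" using x by auto
    then show "Y \<in> fam (insert x V)" using F unfolding fam_def by blast
  qed
qed

text \<open>A closed set that meets the orbit contains all of it. Hence \<open>F\<close> takes the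
  new cycle as a whole or not at all, which gives the two families.\<close>

lemma fam_cyclic:
  assumes V: "cyc_closed V" and x: "x \<in> X" "x \<notin> V"
    and p: "0 < p" "(nx ^^ p) x = x" and Orb: "Orb = (\<lambda>i. (nx ^^ i) x) ` {..<p}"
  shows "cyc_closed (V \<union> Orb)" "Orb \<inter> V = {}"
    "fam (V \<union> Orb) = (\<lambda>Y. Y \<union> Orb) ` fam V \<union> (\<lambda>Y. Y \<union> al ` Orb) ` fam V"
proof -
  have cx: "cyclic x" using p unfolding cyclic_def by auto
  have xO: "x \<in> Orb" unfolding Orb using p by (auto intro!: image_eqI[of _ _ 0])
  have OX: "Orb \<subseteq> X" unfolding Orb using funpow_X x by auto
  have Oc: "\<forall>y\<in>Orb. cyclic y" unfolding Orb using cyclic_funpow[OF cx] by auto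
  have nO: "nx ` Orb \<subseteq> Orb"
  proof -
    have "nx ((nx ^^ i) x) \<in> Orb" if "i < p" for i
    proof (cases "Suc i = p")
      case True
      then have "nx ((nx ^^ i) x) = x" using p(2) by auto
      then show ?thesis using xO by simp
    next
      case False
      then show ?thesis unfolding Orb using that by (intro image_eqI[of _ _ "Suc i"]) auto
    qed
    then show ?thesis unfolding Orb by auto
  qed
  have full: "Orb \<subseteq> F" if "nx ` F \<subseteq> F" "y \<in> F" "y \<in> Orb" for F y
  proof -
    obtain i where "y = (nx ^^ i) x" using \<open>y \<in> Orb\<close> unfolding Orb by auto
    then have "x \<in> F" using orbit_back[OF p(2,1), of i] funpow_mem[OF that(1,2)] by metis
    then show ?thesis unfolding Orb using funpow_mem[OF that(1)] by auto
  qed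
  show disj: "Orb \<inter> V = {}"
  proof (rule ccontr)
    assume "Orb \<inter> V \<noteq> {}"
    then obtain y where y: "y \<in> Orb" "y \<in> V" by auto
    \<comment> \<open>\<open>V\<close> itself need not be closed under \<open>nx\<close> because of
      its acyclic members, so the argument is applied to its cyclic part.\<close>
    have "nx ` {z \<in> V. cyclic z} \<subseteq> {z \<in> V. cyclic z}"
      using V cyclic_nx unfolding cyc_closed_def by auto
    from full[OF this _ y(1)] have "Orb \<subseteq> V" using y Oc by auto
    then show False using xO x by auto
  qed
  show "cyc_closed (V \<union> Orb)" using V OX nO unfolding cyc_closed_def by auto
  show "fam (V \<union> Orb) = (\<lambda>Y. Y \<union> Orb) ` fam V \<union> (\<lambda>Y. Y \<union> al ` Orb) ` fam V" (is "_ = ?A \<union> ?B")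
  proof (intro equalityI subsetI)
    fix Y assume "Y \<in> fam (V \<union> Orb)"
    then obtain F where F: "Y = (V \<union> Orb - F) \<union> al ` F" "F \<subseteq> V \<union> Orb" "\<forall>x\<in>F. cyclic x"
      "nx ` F \<subseteq> F" unfolding fam_def by auto
    show "Y \<in> ?A \<union> ?B"
    proof (cases "F \<inter> Orb = {}")
      case True
      then have "Y = ((V - F) \<union> al ` F) \<union> Orb" "F \<subseteq> V" using F by auto
      then have "Y \<in> ?A" using F unfolding fam_def by blast
      then show ?thesis by simp
    next
      case False
      then have OF: "Orb \<subseteq> F" using full[OF F(4)] by auto
      let ?G = "F - Orb"
      have "nx ` ?G \<subseteq> ?G"
      proof
        fix z assume "z \<in> nx ` ?G"
        then obtain y where y: "z = nx y" "y \<in> F" "y \<notin> Orb" by auto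
        have "z \<notin> Orb"
        proof
          assume "z \<in> Orb"
          have "y \<in> V" "cyclic y" using y F by auto
          then have "z \<in> V" using V y unfolding cyc_closed_def by auto
          then show False using \<open>z \<in> Orb\<close> disj by auto
        qed
        then show "z \<in> ?G" using y F by auto
      qed
      moreover have "?G \<subseteq> V" "\<forall>x\<in>?G. cyclic x" using F by auto
      ultimately have "(V - ?G) \<union> al ` ?G \<in> fam V" unfolding fam_def by blast
      moreover have "Y = ((V - ?G) \<union> al ` ?G) \<union> al ` Orb" using F(1) OF disj by auto
      ultimately have "Y \<in> ?B" by blast
      then show ?thesis by simp
    qed
  next
    fix Y assume "Y \<in> ?A \<union> ?B"
    then show "Y \<in> fam (V \<union> Orb)"
    proof
      assume "Y \<in> ?A"
      then obtain F where F: "Y = ((V - F) \<union> al ` F) \<union> Orb" "F \<subseteq> V" "\<forall>x\<in>F. cyclic x"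
        "nx ` F \<subseteq> F" unfolding fam_def by auto
      then have "Y = (V \<union> Orb - F) \<union> al ` F" using disj by auto
      then show ?thesis using F unfolding fam_def by blast
    next
      assume "Y \<in> ?B"
      then obtain F where F: "Y = ((V - F) \<union> al ` F) \<union> al ` Orb" "F \<subseteq> V" "\<forall>x\<in>F. cyclic x"
        "nx ` F \<subseteq> F" unfolding fam_def by auto
      then have "Y = (V \<union> Orb - (F \<union> Orb)) \<union> al ` (F \<union> Orb)" using disj by auto
      moreover have "F \<union> Orb \<subseteq> V \<union> Orb" "\<forall>x\<in>F \<union> Orb. cyclic x" "nx ` (F \<union> Orb) \<subseteq> F \<union> Orb"
        using F Oc nO by auto
      ultimately show ?thesis unfolding fam_def by blast
    qed
  qed
qed

text \<open>Flipping keeps left ends and permutes right ends, as \<open>nx\<close> permutes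
  \<open>F\<close>. Conversely, a perfect matching \<open>Y\<close> comes from flipping
  \<open>X - Y\<close>, on which \<open>nx\<close> is an injective self-map.\<close>

lemma fam_all: "fam X = {Y. pm Y}"
proof (intro equalityI subsetI CollectI)
  fix Y assume "Y \<in> fam X"
  then obtain F where F: "Y = (X - F) \<union> al ` F" "F \<subseteq> X" "\<forall>x\<in>F. cyclic x" "nx ` F \<subseteq> F"
    unfolding fam_def by auto
  have inj: "inj_on nx F" using F nx_inj_cyclic by (auto simp: inj_on_def)
  have nF: "nx ` F = F" using F inj finX by (meson endo_inj_surj finite_subset)
  have aL: "L (al x) = L x" and aR: "R (al x) = R (nx x)" if "x \<in> F" for x
    using that F XE al nx by auto
  have XL: "L ` X = L ` Ed" and XR: "R ` X = R ` Ed" using X unfolding pm_def by auto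
  have "L ` al ` F = L ` F" using aL by (auto simp: image_image)
  then have "L ` Y = L ` X" using F by (auto simp: image_Un)
  moreover have "R ` al ` F = R ` nx ` F" using aR by (simp add: image_image)
  then have "R ` Y = R ` X" using F nF by (auto simp: image_Un)
  moreover have "Y \<subseteq> Ed" using F XE al by auto
  moreover have "inj_on L Y"
  proof -
    have "\<exists>z\<in>X. L y = L z \<and> (y = (if z \<in> F then al z else z))" if "y \<in> Y" for y
      using that F aL by auto
    then show ?thesis unfolding inj_on_def using pm_L[OF X] by metis
  qed
  moreover have "inj_on R Y"
  proof -
    have y: "(y \<in> X \<and> y \<notin> F) \<or> (\<exists>u\<in>F. y = al u)" if "y \<in> Y" for y
      using that F(1) by auto
    have mixed: "R y \<noteq> R (al u)" if "y \<in> X" "y \<notin> F" "u \<in> F" for y u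
    proof
      assume "R y = R (al u)"
      then have "y = nx u" using pm_R[OF X] aR that F nx by (metis subsetD)
      then show False using that F by auto
    qed
    have flipped: "u = v" if "R (al u) = R (al v)" "u \<in> F" "v \<in> F" for u v
    proof -
      have "nx u = nx v" using pm_R[OF X] aR that F nx by (metis subsetD)
      then show ?thesis using inj_onD[OF inj] that by blast
    qed
    show ?thesis
    proof (rule inj_onI)
      fix y z assume yz: "y \<in> Y" "z \<in> Y" "R y = R z"
      then show "y = z"
        using y[OF yz(1)] y[OF yz(2)] mixed flipped pm_R[OF X] by metis
    qed
  qed
  ultimately show "pm Y" using XL XR unfolding pm_def by auto
next
  fix Y assume "Y \<in> {Y. pm Y}"
  then have Y: "pm Y" by simp
  define F where "F = X - Y"
  have alY: "al x \<in> Y" if "x \<in> F" for x using pm_choice[OF Y, of x] that XE F_def by auto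
  have YE: "Y \<subseteq> Ed" using Y unfolding pm_def by auto
  have nF: "nx ` F \<subseteq> F"
  proof
    fix z assume "z \<in> nx ` F"
    then obtain x where x: "z = nx x" "x \<in> F" by auto
    \<comment> \<open>If \<open>nx x\<close> were in \<open>Y\<close>, it would share its right end
      with \<open>al x\<close>, also in \<open>Y\<close>, and so equal it. Then it has the left end
      of \<open>x\<close>, and within \<open>X\<close> this forces \<open>nx x = x\<close>, although
      \<open>x\<close> is not in \<open>Y\<close>.\<close>
    have "z \<notin> Y"
    proof
      assume zY: "z \<in> Y"
      have "R z = R (al x)" using x nx F_def by auto
      then have "z = al x" using pm_R[OF Y zY alY[OF x(2)]] by auto
      then have "L z = L x" using al x XE F_def by auto
      then have "z = x" using pm_L[OF X] x nx F_def by auto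
      then show False using zY x F_def by auto
    qed
    then show "z \<in> F" using x nx F_def by auto
  qed
  have "inj_on nx F"
  proof (rule inj_onI)
    fix x y assume xy: "x \<in> F" "y \<in> F" "nx x = nx y"
    then have "R (al x) = R (al y)" using nx F_def by (metis DiffD1)
    then have "al x = al y" using pm_R[OF Y] alY xy by auto
    then have "L x = L y" using al xy F_def XE by (metis DiffD1 subsetD)
    then show "x = y" using pm_L[OF X] xy F_def by auto
  qed
  then have cyc: "\<forall>x\<in>F. cyclic x" using cyclic_if_inj_on[OF _ nF] finX F_def by auto
  have "Y = (X - F) \<union> al ` F"
  proof
    show "(X - F) \<union> al ` F \<subseteq> Y" using alY F_def by auto
    show "Y \<subseteq> (X - F) \<union> al ` F"
    proof
      fix y assume y: "y \<in> Y"
      then have "L y \<in> L ` X" using YE X unfolding pm_def by auto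
      then obtain x where x: "x \<in> X" "L x = L y" by auto
      show "y \<in> (X - F) \<union> al ` F"
      proof (cases "x \<in> Y")
        case True
        then have "x = y" using pm_L[OF Y] x y by auto
        then show ?thesis using x True F_def by auto
      next
        case False
        then have "x \<in> F" using x F_def by auto
        then have "al x = y" using pm_L[OF Y alY y] x XE al F_def by auto
        then show ?thesis using \<open>x \<in> F\<close> by auto
      qed
    qed
  qed
  then show "Y \<in> fam X" using nF cyc F_def unfolding fam_def by blast
qed

end

section \<open>Tables indexed by sets of joins\<close>

definition bits :: "nat \<Rightarrow> nat set" where
  "bits S = {j. bit S j}"

lemma bits_0 [simp]: "bits 0 = {}"
  by (simp add: bits_def)

lemma bits_eq_empty: "bits S = {} \<longleftrightarrow> S = 0"
  unfolding bits_def by (metis (no_types, lifting) bit_0_eq bit_eqI bot_apply empty_Collect_eq bot_bool_def)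

lemma bits_exp [simp]: "bits (2 ^ j) = {j}"
  by (auto simp: bits_def bit_exp_iff)

lemma bits_full: "bits (2 ^ c - 1) = {..<c}"
  unfolding bits_def mask_eq_exp_minus_1[symmetric] by (auto simp: bit_mask_iff)

text \<open>
  Removes the element \<open>j\<close> from the set coded by \<open>S\<close> when \<open>p = 2 ^ j\<close>. For \<open>p = 0\<close>, the code of an edge that
  satisfies no join, it is the identity because \<open>S mod 0 = S\<close>.
\<close>

definition clear :: "nat \<Rightarrow> nat \<Rightarrow> nat" where
  "clear p S = (if p \<le> S mod (p + p) then S - p else S)"

lemma clear_0 [simp]: "clear 0 S = S"
  by (simp add: clear_def)

lemma clear_le: "clear p S \<le> S"
  by (simp add: clear_def)

text \<open>Bit \<open>j\<close> of \<open>S\<close> is set exactly if the residue of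
  \<open>S\<close> modulo \<open>2 ^ (j + 1)\<close> is at least \<open>2 ^ j\<close>. Residues can
  be tracked by counting, which replaces bit operations in the program.\<close>

lemma bits_clear_exp:
  includes bit_operations_syntax
  shows "bits (clear (2 ^ j) S) = bits S - {j}"
proof -
  have "S mod (2 ^ j * 2) = 2 ^ j * (S div 2 ^ j mod 2) + S mod 2 ^ j"
    by (rule mod_mult2_eq)
  moreover have "S mod 2 ^ j < 2 ^ j" by simp
  ultimately have b: "2 ^ j \<le> S mod (2 ^ j + 2 ^ j) \<longleftrightarrow> bit S j"
    unfolding mult_2_right[symmetric] bit_iff_odd
    by (cases "odd (S div 2 ^ j)") (auto simp: odd_iff_mod_2_eq_one not_le)
  show ?thesis
  proof (cases "bit S j")
    case True
    have "unset_bit j S OR 2 ^ j = S" using True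
      by (intro bit_eqI) (auto simp: bit_simps)
    moreover have "unset_bit j S AND 2 ^ j = 0"
      by (intro bit_eqI) (auto simp: bit_simps)
    ultimately have "S = unset_bit j S + 2 ^ j" by (simp add: disjunctive_add_eq_or)
    then have "S - 2 ^ j = unset_bit j S" by simp
    then show ?thesis using True b by (auto simp: clear_def bits_def bit_unset_bit_iff)
  next
    case False
    then show ?thesis using b by (auto simp: clear_def bits_def)
  qed
qed

lemma bits_clear: "p = 0 \<or> (\<exists>j. p = 2 ^ j) \<Longrightarrow> bits (clear p S) = bits S - bits p"
  using bits_clear_exp by auto

text \<open>The joins in \<open>S\<close> are a lower requirement: further joins may be satisfied
  too, and several edges may satisfy the same one. The infimum of the empty set, infinity, marks an
  impossible \<open>S\<close>.\<close>

definition best :: "(nat \<Rightarrow> ereal) \<Rightarrow> (nat \<Rightarrow> nat) \<Rightarrow> nat set set \<Rightarrow> nat \<Rightarrow> ereal" where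
  "best w pw \<F> S = (INF Y\<in>{Y \<in> \<F>. bits S \<subseteq> (\<Union>e\<in>Y. bits (pw e))}. \<Sum>e\<in>Y. w e)"

lemma best_init: "best w pw {{}} S = (if S = 0 then 0 else \<infinity>)"
proof -
  have "{Y \<in> {{}}. bits S \<subseteq> (\<Union>e\<in>Y. bits (pw e))} = (if S = 0 then {{}} else {})"
    using bits_eq_empty by auto
  then show ?thesis by (simp add: best_def top_ereal_def)
qed

lemma best_Un: "best w pw (\<F> \<union> \<G>) S = min (best w pw \<F> S) (best w pw \<G> S)"
proof -
  have "{Y \<in> \<F> \<union> \<G>. P Y} = {Y \<in> \<F>. P Y} \<union> {Y \<in> \<G>. P Y}" for P by auto
  then show ?thesis by (simp only: best_def INF_union inf_min)
qed

text \<open>The common edge \<open>f\<close> takes care of its own join, so the rest has to cover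
  only \<open>S\<close> without it. Nonnegativity permits moving \<open>w f\<close> out of the
  infimum; the empty family is treated apart.\<close>

lemma best_insert:
  assumes fam: "\<And>Y. Y \<in> \<F> \<Longrightarrow> finite Y \<and> f \<notin> Y \<and> (\<forall>e\<in>Y. 0 \<le> w e)" and w: "0 \<le> w f"
    and p: "pw f = 0 \<or> (\<exists>j. pw f = 2 ^ j)"
  shows "best w pw (insert f ` \<F>) S = w f + best w pw \<F> (clear (pw f) S)"
proof -
  let ?I = "{Y \<in> \<F>. bits (clear (pw f) S) \<subseteq> (\<Union>e\<in>Y. bits (pw e))}"
  have eq: "{Y \<in> insert f ` \<F>. bits S \<subseteq> (\<Union>e\<in>Y. bits (pw e))} = insert f ` ?I"
  proof -
    have "bits (clear (pw f) S) \<subseteq> (\<Union>e\<in>Y. bits (pw e)) \<longleftrightarrow>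
        bits S \<subseteq> (\<Union>e\<in>insert f Y. bits (pw e))" for Y
      unfolding bits_clear[OF p] by (simp add: Diff_subset_conv)
    then show ?thesis by (simp only:) blast
  qed
  have "best w pw (insert f ` \<F>) S = (INF Y\<in>?I. \<Sum>e\<in>insert f Y. w e)"
    unfolding best_def eq by (simp add: image_image)
  also have "\<dots> = (INF Y\<in>?I. w f + (\<Sum>e\<in>Y. w e))"
    using fam by (intro INF_cong) auto
  also have "\<dots> = w f + best w pw \<F> (clear (pw f) S)"
  proof (cases "?I = {}")
    case True
    then show ?thesis unfolding best_def True using w by (auto simp: top_ereal_def)
  next
    case False
    then show ?thesis unfolding best_def using fam w
      by (intro INF_ereal_add_right) (auto intro: sum_nonneg)
  qed
  finally show ?thesis .
qed

text \<open>A finite family attains its infimum unless no member qualifies, and then the value is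
  infinite and not below a real bound.\<close>

lemma best_le_iff:
  assumes "finite \<F>"
  shows "best w pw \<F> S \<le> ereal x \<longleftrightarrow>
    (\<exists>Y\<in>\<F>. bits S \<subseteq> (\<Union>e\<in>Y. bits (pw e)) \<and> (\<Sum>e\<in>Y. w e) \<le> ereal x)"
proof -
  let ?I = "{Y \<in> \<F>. bits S \<subseteq> (\<Union>e\<in>Y. bits (pw e))}"
  have fin: "finite (sum w ` ?I)" using assms by auto
  show ?thesis
  proof
    assume l: "best w pw \<F> S \<le> ereal x"
    have "?I \<noteq> {}"
    proof
      assume "?I = {}"
      then have "best w pw \<F> S = \<infinity>" unfolding best_def by (simp only:) (simp add: top_ereal_def)
      then show False using l by simp
    qed
    then have "Inf (sum w ` ?I) \<in> sum w ` ?I"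
      using fin Min_in[OF fin] by (simp add: Min_Inf)
    then show "\<exists>Y\<in>\<F>. bits S \<subseteq> (\<Union>e\<in>Y. bits (pw e)) \<and> (\<Sum>e\<in>Y. w e) \<le> ereal x"
      using l unfolding best_def by auto
  next
    assume "\<exists>Y\<in>\<F>. bits S \<subseteq> (\<Union>e\<in>Y. bits (pw e)) \<and> (\<Sum>e\<in>Y. w e) \<le> ereal x"
    then obtain Y where Y: "Y \<in> ?I" "(\<Sum>e\<in>Y. w e) \<le> ereal x" by auto
    have "best w pw \<F> S \<le> (\<Sum>e\<in>Y. w e)" unfolding best_def using Y(1) by (rule INF_lower)
    then show "best w pw \<F> S \<le> ereal x" using Y(2) by (rule order_trans)
  qed
qed

section \<open>The program\<close>

notation Seq (infixr ";;" 60)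

definition powers :: com where
  "powers = NSet ''W'' (NConst 1) ;; For ''j'' ''c'' (NSet ''W'' (NAdd (Var ''W'') (Var ''W'')))"

lemma ok_powers:
  assumes "nmem s ''c'' 0 = c"
  shows "ok powers s (100 * (c + 1)) (\<lambda>s'. nmem s' ''W'' 0 = 2 ^ c)"
  unfolding powers_def
proof (rule ok_Seq[where bP = 3 and bQ = "(c + 1) * (10 + 20)"])
  show "ok (NSet ''W'' (NConst 1)) s 3 (\<lambda>s1. nmem s1 ''W'' 0 = 1)"
    by (rule ok_run) auto
next
  fix s1
  assume W: "nmem s1 ''W'' 0 = 1"
    and H: "agree_off (nmods (NSet ''W'' (NConst 1))) (wmods (NSet ''W'' (NConst 1))) s s1"
  have c: "nmem s1 ''c'' 0 = c" using assms agree_off_nmem[OF H] by simp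
  show "ok (For ''j'' ''c'' (NSet ''W'' (NAdd (Var ''W'') (Var ''W'')))) s1 ((c + 1) * (10 + 20))
          (\<lambda>s'. nmem s' ''W'' 0 = 2 ^ c)"
    by (rule ok_For[where Inv = "\<lambda>i s. nmem s ''W'' 0 = 2 ^ i" and B = 10 and C = 30 and N = c])
      (use W c in \<open>auto intro!: ok_run\<close>)
qed simp

definition join_match :: bexp where
  "join_match =
     (let a = NRead ''cell'' (NRead ''left'' (Var ''i'')); b = NRead ''cell'' (NRead ''right'' (Var ''i''));
          x = NRead ''join1'' (Var ''j''); y = NRead ''join2'' (Var ''j'')
      in BOr (BAnd (NEq a x) (NEq b y)) (BAnd (NEq a y) (NEq b x)))"

definition join_mask_step :: com where
  "join_mask_step =
     Cond join_match (NAssign ''pw'' (NAdd (Var ''i'') (NConst 1)) (Var ''q'')) Skip ;;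
     NSet ''q'' (NAdd (Var ''q'') (Var ''q''))"

definition join_masks :: com where
  "join_masks = For ''i'' ''m'' (NSet ''q'' (NConst 1) ;;
     NAssign ''pw'' (NAdd (Var ''i'') (NConst 1)) (NConst 0) ;; For ''j'' ''c'' join_mask_step)"

text \<open>Stated for an arbitrary test \<open>mt\<close>, where a later match overwrites an
  earlier one. That at most one join matches an edge is shown in \<open>mask_bits\<close>.\<close>

definition mask_spec :: "(nat \<Rightarrow> bool) \<Rightarrow> nat \<Rightarrow> nat \<Rightarrow> bool" where
  "mask_spec mt c q \<longleftrightarrow> (q = 0 \<and> (\<forall>j<c. \<not> mt j)) \<or> (\<exists>j<c. mt j \<and> q = 2 ^ j)"

lemma mask_spec_Suc:
  "mask_spec mt c q \<Longrightarrow> mask_spec mt (Suc c) (if mt c then 2 ^ c else q)"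
  unfolding mask_spec_def by (auto simp: less_Suc_eq)

definition join_of :: "store \<Rightarrow> nat \<Rightarrow> nat \<Rightarrow> bool" where
  "join_of s i j \<longleftrightarrow>
     (let a = nmem s ''cell'' (nmem s ''left'' i); b = nmem s ''cell'' (nmem s ''right'' i);
          x = nmem s ''join1'' j; y = nmem s ''join2'' j
      in a = x \<and> b = y \<or> a = y \<and> b = x)"

lemma ok_join_masks:
  assumes m: "nmem s ''m'' 0 = m" and c: "nmem s ''c'' 0 = c"
  shows "ok join_masks s ((m + 1) * (200 * (c + 1)))
    (\<lambda>s'. \<forall>i<m. mask_spec (join_of s i) c (nmem s' ''pw'' (Suc i)))"
  unfolding join_masks_def
proof (rule ok_For[where N = m and B = "120 * (c + 1) + 20" and C = "200 * (c + 1)" and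
        Inv = "\<lambda>k s'. \<forall>i<k. mask_spec (join_of s i) c (nmem s' ''pw'' (Suc i))"], goal_cases)
  case (6 i s1)
  note [simp] = join_mask_step_def agree_off_nmem[OF 6(2)]
  let ?pre = "\<lambda>s2. nmem s2 ''q'' 0 = 1 \<and> nmem s2 ''pw'' (Suc i) = 0 \<and> nmem s2 ''i'' 0 = i \<and>
     (\<forall>i'<i. mask_spec (join_of s i') c (nmem s2 ''pw'' (Suc i')))"
  show ?case
  proof (rule ok_Seq[where bP = 3 and bQ = "120 * (c + 1) + 10"])
    show "ok (NSet ''q'' (NConst 1)) s1 3 (\<lambda>s2. s2 = nupd ''q'' 0 1 s1)" by (rule ok_run) auto
  next
    fix s2 assume s2: "s2 = nupd ''q'' 0 1 s1"
    show "ok (NAssign ''pw'' (NAdd (Var ''i'') (NConst 1)) (NConst 0) ;; For ''j'' ''c'' join_mask_step) s2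
       (120 * (c + 1) + 10)
       (\<lambda>s2. \<forall>i'<Suc i. mask_spec (join_of s i') c (nmem (nupd ''i'' 0 (Suc i) s2) ''pw'' (Suc i')))"
    proof (rule ok_Seq[where bP = 10 and bQ = "120 * (c + 1)"])
      show "ok (NAssign ''pw'' (NAdd (Var ''i'') (NConst 1)) (NConst 0)) s2 10
         (\<lambda>s3. s3 = nupd ''pw'' (Suc i) 0 s2)" 
        using 6 s2 by (intro ok_run) auto
    next
      fix s3 assume s3: "s3 = nupd ''pw'' (Suc i) 0 s2"
      have in3: "nmem s3 ''c'' 0 = c" "join_of s3 = join_of s"
        using c s2 s3 by (auto simp: join_of_def fun_eq_iff)
      show "ok (For ''j'' ''c'' join_mask_step) s3 (120 * (c + 1))
         (\<lambda>s2. \<forall>i'<Suc i. mask_spec (join_of s i') c (nmem (nupd ''i'' 0 (Suc i) s2) ''pw'' (Suc i')))"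
      proof (rule ok_For[where N = c and B = 100 and C = 120 and
          Inv = "\<lambda>k s'. mask_spec (join_of s i) k (nmem s' ''pw'' (Suc i)) \<and> nmem s' ''q'' 0 = 2 ^ k \<and>
             (\<forall>i'<i. mask_spec (join_of s i') c (nmem s' ''pw'' (Suc i')))"], goal_cases)
        case (6 j s4)
        note fr = agree_off_nmem[OF 6(2)]
        have i4: "nmem s4 ''i'' 0 = i" using fr s2 s3 \<open>nmem s1 ''i'' 0 = i\<close> by simp
        have "join_of s4 = join_of s3" using fr by (simp add: join_of_def fun_eq_iff)
        then have b: "bval join_match s4 \<longleftrightarrow> join_of s i j"
          using in3 i4 6(3) by (simp add: join_match_def join_of_def fun_eq_iff Let_def)
        have cost: "bcost join_match \<le> 80" by (simp add: join_match_def Let_def)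
        have "max_cost join_mask_step \<le> 100" using cost by simp
        moreover have "loop_free join_mask_step" by simp
        ultimately show ?case
          apply (intro ok_run)
            apply assumption+
          using 6(4) mask_spec_Suc[of "join_of s i" j] b i4 by (auto simp del: One_nat_def split: if_splits)
      qed (use 6 s2 s3 in3 in \<open>auto simp: mask_spec_def less_Suc_eq\<close>)
    qed simp
  qed simp
qed (use m in \<open>auto simp: join_mask_step_def\<close>)

definition alternate_step :: com where
  "alternate_step =
     Cond (BAnd (NEq (NRead ''left'' (Var ''j'')) (NRead ''left'' (Var ''i''))) (BNot (NEq (Var ''j'') (Var ''i''))))
       (NAssign ''al'' (NAdd (Var ''i'') (NConst 1)) (NAdd (Var ''j'') (NConst 1))) Skip"

definition alternates :: com where
  "alternates = For ''i'' ''m''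
     (NAssign ''al'' (NAdd (Var ''i'') (NConst 1)) (NAdd (Var ''i'') (NConst 1)) ;;
      For ''j'' ''m'' alternate_step)"

text \<open>The first alternative keeps the initial value, the edge itself. The scan is correct for
  any degree; the degree bound is needed only to know that the edge found is the unique other
  one.\<close>

definition alt_spec :: "(nat \<Rightarrow> nat) \<Rightarrow> nat \<Rightarrow> nat \<Rightarrow> nat \<Rightarrow> bool" where
  "alt_spec lf k i a \<longleftrightarrow>
     (a = Suc i \<and> (\<forall>j<k. lf j = lf i \<longrightarrow> j = i)) \<or> (\<exists>j<k. j \<noteq> i \<and> lf j = lf i \<and> a = Suc j)"

lemma alt_spec_Suc:
  "alt_spec lf k i a \<Longrightarrow> alt_spec lf (Suc k) i (if lf k = lf i \<and> k \<noteq> i then Suc k else a)"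
  unfolding alt_spec_def by (auto simp: less_Suc_eq)

lemma ok_alternates:
  assumes m: "nmem s ''m'' 0 = m"
  shows "ok alternates s ((m + 1) * (200 * (m + 1)))
    (\<lambda>s'. nmem s' ''al'' 0 = nmem s ''al'' 0 \<and>
      (\<forall>i<m. alt_spec (nmem s ''left'') m i (nmem s' ''al'' (Suc i))))"
  unfolding alternates_def
proof (rule ok_For[where N = m and B = "100 * (m + 1) + 20" and C = "200 * (m + 1)" and
      Inv = "\<lambda>k s'. nmem s' ''al'' 0 = nmem s ''al'' 0 \<and>
         (\<forall>i<k. alt_spec (nmem s ''left'') m i (nmem s' ''al'' (Suc i)))"], goal_cases)
  case (6 i s1)
  note [simp] = alternate_step_def agree_off_nmem[OF 6(2)]
  show ?case
  proof (rule ok_Seq_run[where bQ = "100 * (m + 1)"], goal_cases)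
    case 3
    show ?case
    proof (rule ok_For[where N = m and B = 50 and C = 100 and
          Inv = "\<lambda>k s'. nmem s' ''al'' 0 = nmem s ''al'' 0 \<and>
            alt_spec (nmem s ''left'') k i (nmem s' ''al'' (Suc i)) \<and>
            (\<forall>i'<i. alt_spec (nmem s ''left'') m i' (nmem s' ''al'' (Suc i')))"], goal_cases)
      case (6 j s2)
      note fr = agree_off_nmem[OF 6(2)]
      show ?case
        using 6(3,4) alt_spec_Suc[of "nmem s ''left''" j i "nmem s2 ''al'' (Suc i)"]
          fr[of "''i''"] fr[of "''left''"] \<open>nmem s1 ''i'' 0 = i\<close>
        by (intro ok_run) (auto split: if_splits)
    qed (use 6 m in \<open>auto simp: alt_spec_def less_Suc_eq\<close>)
  qed auto
qed (use m in \<open>auto simp: alternate_step_def\<close>)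

subsection \<open>Finding a perfect matching\<close>

definition walk_step :: com where
  "walk_step = Cond (NEq (Var ''cur'') (NConst 0)) Skip
     (NSet ''o'' (NRead ''own'' (NRead ''right'' (NSub (Var ''cur'') (NConst 1)))) ;;
      NAssign ''own'' (NRead ''right'' (NSub (Var ''cur'') (NConst 1))) (Var ''cur'') ;;
      NSet ''cur'' (NRead ''al'' (Var ''o'')))"

definition insert_edge :: com where
  "insert_edge =
     (NAssign ''d'' (NRead ''left'' (Var ''i'')) (NConst 1) ;;
      NSet ''cur'' (NAdd (Var ''i'') (NConst 1))) ;;
     For ''t'' ''g'' walk_step ;;
     Cond (NEq (Var ''cur'') (NConst 0)) Skip
       (NAssign ''d'' (NRead ''left'' (NSub (Var ''cur'') (NConst 1))) (NConst 0))"

text \<open>The limit \<open>g\<close> is \<open>2 * m + 2\<close>, one more than the largest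
  possible potential. Scanning edges instead of vertices supplies each left vertex with a first edge
  to try; \<open>d\<close> prevents inserting a vertex that is already covered.\<close>

definition insertion :: com where
  "insertion =
     NSet ''g'' (NAdd (NAdd (Var ''m'') (Var ''m'')) (NConst 2)) ;;
     For ''i'' ''m'' (Cond (NEq (NRead ''d'' (NRead ''left'' (Var ''i''))) (NConst 0)) insert_edge Skip)"

locale edges = two_choice +
  fixes m :: nat
  assumes Ed: "Ed = {1..m}"
begin

text \<open>The input arrays start at index 0, hence the shift by one. The computed array
  \<open>al\<close> is indexed by edge numbers, and its entry at 0 must be 0 so that following the
  absent edge stops a walk.\<close>

definition edge_arrays :: "store \<Rightarrow> bool" where
  "edge_arrays s \<longleftrightarrow> nmem s ''m'' 0 = m \<and> nmem s ''al'' = al \<and>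
     (\<forall>e\<in>Ed. nmem s ''left'' (e - 1) = L e \<and> nmem s ''right'' (e - 1) = R e)"

lemma edge_arrays_cong:
  assumes "agree_off X Z s s'" "''m'' \<notin> X" "''al'' \<notin> X" "''left'' \<notin> X" "''right'' \<notin> X"
    "edge_arrays s"
  shows "edge_arrays s'"
  using assms(2-6) agree_off_nmem[OF assms(1)] by (simp add: edge_arrays_def)

lemma edge_arrays_nupd:
  "x \<notin> {''m'', ''al'', ''left'', ''right''} \<Longrightarrow> edge_arrays s \<Longrightarrow> edge_arrays (nupd x i k s)"
  by (auto simp: edge_arrays_def)

lemma card_Ed: "card Ed = m"
  by (simp add: Ed)

text \<open>As long as the walk continues, potential plus completed rounds is at most
  \<open>2 * m + 1\<close>, which is impossible after \<open>2 * m + 2\<close> rounds. The invariant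
  refers to all perfect matchings because the program knows none of them.\<close>

lemma ok_walk:
  assumes s: "edge_arrays s" "nmem s ''g'' 0 = 2 * m + 2"
    and i: "ins_inv (nmem s ''own'') D (nmem s ''cur'' 0)"
  shows "ok (For ''t'' ''g'' walk_step) s ((2 * m + 3) * 100)
    (\<lambda>s'. ins_inv (nmem s' ''own'') D (nmem s' ''cur'' 0) \<and> ((\<exists>Y. pm Y) \<longrightarrow> nmem s' ''cur'' 0 = 0))"
proof (rule ok_For[where N = "2 * m + 2" and B = 60 and C = 100 and
      Inv = "\<lambda>k s'. ins_inv (nmem s' ''own'') D (nmem s' ''cur'' 0) \<and>
        (\<forall>Y. pm Y \<longrightarrow> nmem s' ''cur'' 0 = 0 \<or>
           potential Y (nmem s' ''own'') (nmem s' ''cur'' 0) + k \<le> 2 * m + 1)"], goal_cases)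
  case (6 k s1)
  let ?own = "nmem s1 ''own''" and ?cur = "nmem s1 ''cur'' 0"
  have e1: "edge_arrays s1"
    by (rule edge_arrays_cong[OF 6(2) _ _ _ _ s(1)]) (auto simp: walk_step_def)
  show ?case
  proof (cases "?cur = 0")
    case True
    then show ?thesis using 6 by (intro ok_run) (auto simp: walk_step_def)
  next
    case False
    then have "?cur \<in> Ed" using 6(4) unfolding ins_inv_def by auto
    then have R: "nmem s1 ''right'' (?cur - Suc 0) = R ?cur" and al: "nmem s1 ''al'' = al"
      using e1 by (auto simp: edge_arrays_def)
    have st: "ins_inv (?own(R ?cur := ?cur)) D (al (?own (R ?cur)))"
      using 6(4) False by (intro ins_inv_step) auto
    have "al (?own (R ?cur)) = 0 \<or>
        potential Y (?own(R ?cur := ?cur)) (al (?own (R ?cur))) + Suc k \<le> 2 * m + 1" if "pm Y" for Y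
    proof (cases "?own (R ?cur) = 0")
      case True
      then show ?thesis using zero by simp
    next
      case o: False
      then show ?thesis
        using potential_step[OF that _ False, of ?own D] 6(4) that False by fastforce
    qed
    then show ?thesis using st False R al by (intro ok_run) (auto simp: walk_step_def)
  qed
next
  case 5
  then show ?case using i potential_le by (auto simp: card_Ed)
next
  case (9 s')
  then show ?case by auto
qed (use s in \<open>auto simp: walk_step_def\<close>)

lemma ok_insert_edge:
  assumes s: "edge_arrays s" "nmem s ''g'' 0 = 2 * m + 2" "nmem s ''i'' 0 = i" "i < m"
    and inv: "ins_inv (nmem s ''own'') {v. nmem s ''d'' v \<noteq> 0} 0"
    and d: "nmem s ''d'' (L (Suc i)) = 0"
  shows "ok insert_edge s ((2 * m + 3) * 100 + 100)
    (\<lambda>s'. ins_inv (nmem s' ''own'') {v. nmem s' ''d'' v \<noteq> 0} 0 \<and>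
      ((\<exists>Y. pm Y) \<longrightarrow> {v. nmem s' ''d'' v \<noteq> 0} = insert (L (Suc i)) {v. nmem s ''d'' v \<noteq> 0}))"
  unfolding insert_edge_def
proof (rule ok_Seq_run[where bQ = "(2 * m + 3) * 100 + 40"], goal_cases)
  case 3
  let ?D = "insert (L (Suc i)) {v. nmem s ''d'' v \<noteq> 0}"
  let ?s = "nupd ''cur'' 0 (Suc i) (nupd ''d'' (L (Suc i)) 1 s)"
  have iE: "Suc i \<in> Ed" using s by (simp add: Ed)
  then have "nmem s ''left'' i = L (Suc i)" using s(1) unfolding edge_arrays_def by fastforce
  then have run: "run (NAssign ''d'' (NRead ''left'' (Var ''i'')) (NConst 1) ;;
      NSet ''cur'' (NAdd (Var ''i'') (NConst 1))) s = ?s"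
    using s by simp
  have D: "{v. nmem ?s ''d'' v \<noteq> 0} = ?D" by auto
  have e: "edge_arrays ?s" using s(1) by (intro edge_arrays_nupd) auto
  show ?case unfolding run
  proof (rule ok_Seq[where bQ = 40])
    show "ok (For ''t'' ''g'' walk_step) ?s ((2 * m + 3) * 100)
      (\<lambda>s'. ins_inv (nmem s' ''own'') ?D (nmem s' ''cur'' 0) \<and>
         ((\<exists>Y. pm Y) \<longrightarrow> nmem s' ''cur'' 0 = 0))"
      using ins_inv_start[OF inv iE] d s e by (intro ok_walk) auto
  next
    fix s1
    assume 1: "ins_inv (nmem s1 ''own'') ?D (nmem s1 ''cur'' 0) \<and>
         ((\<exists>Y. pm Y) \<longrightarrow> nmem s1 ''cur'' 0 = 0)"
      and H: "agree_off (nmods (For ''t'' ''g'' walk_step)) (wmods (For ''t'' ''g'' walk_step)) ?s s1"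
    have d1: "nmem s1 ''d'' = nmem ?s ''d''"
      by (rule agree_off_nmem[OF H]) (simp add: walk_step_def)
    have e1: "edge_arrays s1"
      by (rule edge_arrays_cong[OF H _ _ _ _ e]) (auto simp: walk_step_def)
    show "ok (Cond (NEq (Var ''cur'') (NConst 0)) Skip
       (NAssign ''d'' (NRead ''left'' (NSub (Var ''cur'') (NConst 1))) (NConst 0))) s1 40
       (\<lambda>s'. ins_inv (nmem s' ''own'') {v. nmem s' ''d'' v \<noteq> 0} 0 \<and>
         ((\<exists>Y. pm Y) \<longrightarrow> {v. nmem s' ''d'' v \<noteq> 0} = ?D))"
    proof (cases "nmem s1 ''cur'' 0 = 0")
      case True
      then have "{v. nmem s1 ''d'' v \<noteq> 0} = ?D" unfolding d1 D by simp
      then show ?thesis using True 1 by (intro ok_run) simp_all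
    next
      case False
      let ?c = "nmem s1 ''cur'' 0"
      have "?c \<in> Ed" using 1 False unfolding ins_inv_def by auto
      then have L: "nmem s1 ''left'' (?c - Suc 0) = L ?c" using e1 by (auto simp: edge_arrays_def)
      \<comment> \<open>The vertex given up is the left end of the current edge, which need not be
        the vertex whose insertion started the walk.\<close>
      have "{v. ((nmem s1 ''d'')(L ?c := 0)) v \<noteq> 0} = ?D - {L ?c}"
        unfolding d1 by auto
      then show ?thesis using False 1 L ins_inv_stop[of _ ?D ?c]
        by (intro ok_run) simp_all
    qed
  qed simp
qed auto

lemma ok_insertion:
  assumes s: "edge_arrays s" "nmem s ''own'' = (\<lambda>_. 0)" "nmem s ''d'' = (\<lambda>_. 0)"
  shows "ok insertion s ((m + 1) * (1000 * (m + 1)))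
    (\<lambda>s'. ins_inv (nmem s' ''own'') {v. nmem s' ''d'' v \<noteq> 0} 0 \<and>
      ((\<exists>Y. pm Y) \<longrightarrow> (\<forall>e\<in>Ed. nmem s' ''d'' (L e) \<noteq> 0)))"
  unfolding insertion_def
proof (rule ok_Seq_run[where bQ = "(m + 1) * ((2 * m + 3) * 100 + 200)"], goal_cases)
  case 3
  let ?s = "nupd ''g'' 0 (2 * m + 2) s"
  have run: "run (NSet ''g'' (NAdd (NAdd (Var ''m'') (Var ''m'')) (NConst 2))) s = ?s"
    using s by (simp add: edge_arrays_def mult_2)
  have e: "edge_arrays ?s" using s(1) by (intro edge_arrays_nupd) auto
  show ?case unfolding run
  proof (rule ok_For[where N = m and B = "(2 * m + 3) * 100 + 150" and C = "(2 * m + 3) * 100 + 200" and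
       Inv = "\<lambda>k s'. ins_inv (nmem s' ''own'') {v. nmem s' ''d'' v \<noteq> 0} 0 \<and>
          ((\<exists>Y. pm Y) \<longrightarrow> (\<forall>i<k. nmem s' ''d'' (L (Suc i)) \<noteq> 0))"], goal_cases)
    case (6 i s1)
    have e1: "edge_arrays s1"
      by (rule edge_arrays_cong[OF 6(2) _ _ _ _ e]) (auto simp: insert_edge_def walk_step_def)
    have g: "nmem s1 ''g'' = nmem ?s ''g''"
      by (rule agree_off_nmem[OF 6(2)]) (auto simp: insert_edge_def walk_step_def)
    have "Suc i \<in> Ed" using 6 by (simp add: Ed)
    then have L: "nmem s1 ''left'' i = L (Suc i)" using e1 unfolding edge_arrays_def by fastforce
    show ?case
    proof (rule ok_Cond[where bP = "(2 * m + 3) * 100 + 100"], goal_cases)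
      case 1
      then have "ok insert_edge s1 ((2 * m + 3) * 100 + 100)
        (\<lambda>s'. ins_inv (nmem s' ''own'') {v. nmem s' ''d'' v \<noteq> 0} 0 \<and>
         ((\<exists>Y. pm Y) \<longrightarrow> {v. nmem s' ''d'' v \<noteq> 0} = insert (L (Suc i)) {v. nmem s1 ''d'' v \<noteq> 0}))"
        using e1 g 6 L by (intro ok_insert_edge) auto
      then show ?case
      proof (rule ok_mono)
        fix s' :: store assume s': "ins_inv (nmem s' ''own'') {v. nmem s' ''d'' v \<noteq> 0} 0 \<and>
         ((\<exists>Y. pm Y) \<longrightarrow> {v. nmem s' ''d'' v \<noteq> 0} = insert (L (Suc i)) {v. nmem s1 ''d'' v \<noteq> 0})"
        have "nmem s' ''d'' (L (Suc j)) \<noteq> 0" if "\<exists>Y. pm Y" "j < Suc i" for j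
        proof -
          have "L (Suc j) \<in> insert (L (Suc i)) {v. nmem s1 ''d'' v \<noteq> 0}"
            using that 6(4) by (auto simp: less_Suc_eq)
          then show ?thesis using s' that(1) by blast
        qed
        then show "ins_inv (nmem (nupd ''i'' 0 (Suc i) s') ''own'') {v. nmem (nupd ''i'' 0 (Suc i) s') ''d'' v \<noteq> 0} 0 \<and>
          ((\<exists>Y. pm Y) \<longrightarrow> (\<forall>j<Suc i. nmem (nupd ''i'' 0 (Suc i) s') ''d'' (L (Suc j)) \<noteq> 0))"
          using s' by simp
      qed simp
    next
      case 2
      then show ?case using 6 L by (intro ok_run) (auto simp: less_Suc_eq)
    qed simp
  next
    case (9 s')
    have "e \<in> Ed \<Longrightarrow> \<exists>i<m. e = Suc i" for e by (auto simp: Ed intro: exI[of _ "e - 1"])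
    then show ?case using 9 by blast
  next
    case 5
    have "held (\<lambda>_. 0) = {}" using zero by (auto simp: held_def)
    then show ?case using s by (simp add: ins_inv_def)
  qed (use s in \<open>auto simp: insert_edge_def walk_step_def edge_arrays_def\<close>)
next
  case 2
  show ?case by (simp add: algebra_simps)
qed auto

end

text \<open>Positions of left and right vertices never coincide: \<open>d\<close> marks covered left
  vertices and \<open>own\<close> is nonzero only at right ones, so the sum tests a vertex without
  asking for its side.\<close>

definition coverage :: com where
  "coverage = NSet ''ok'' (NConst 1) ;;
     For ''i'' ''n'' (Cond (NEq (NAdd (NRead ''own'' (Var ''i'')) (NRead ''d'' (Var ''i''))) (NConst 0))
       (NSet ''ok'' (NConst 0)) Skip)"

lemma ok_coverage:
  assumes n: "nmem s ''n'' 0 = n"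
  shows "ok coverage s ((n + 1) * 100)
    (\<lambda>s'. nmem s' ''ok'' 0 = (if \<forall>v<n. nmem s ''own'' v + nmem s ''d'' v \<noteq> 0 then 1 else 0))"
  unfolding coverage_def
proof (rule ok_Seq_run[where bQ = "(n + 1) * 60"], goal_cases)
  case 3
  show ?case
  proof (rule ok_For[where N = n and B = 40 and C = 60 and
      Inv = "\<lambda>k s'. nmem s' ''ok'' 0 = (if \<forall>v<k. nmem s ''own'' v + nmem s ''d'' v \<noteq> 0 then 1 else 0)"],
      goal_cases)
    case (6 i s1)
    note fr = agree_off_nmem[OF 6(2)]
    have "nmem s1 ''own'' = nmem s ''own''" "nmem s1 ''d'' = nmem s ''d''" using fr by auto
    then show ?case using 6(3,4) by (intro ok_run) (auto simp: less_Suc_eq split: if_splits)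
  qed (use n in auto)
qed auto

subsection \<open>The table\<close>

text \<open>
  The counter \<open>r\<close> runs through \<open>S mod (p + p)\<close>; it is never reset when \<open>p = 0\<close>.
\<close>

definition relax_step :: "string \<Rightarrow> string \<Rightarrow> com" where
  "relax_step dst src =
     Cond (NLe (Var ''p'') (Var ''r''))
       (WAssign dst (Var ''S'') (WAdd (WRead ''w'' (NConst 0)) (WRead src (NSub (Var ''S'') (Var ''p'')))))
       (WAssign dst (Var ''S'') (WAdd (WRead ''w'' (NConst 0)) (WRead src (Var ''S'')))) ;;
     NSet ''r'' (NAdd (Var ''r'') (NConst 1)) ;;
     Cond (NEq (Var ''r'') (NAdd (Var ''p'') (Var ''p''))) (NSet ''r'' (NConst 0)) Skip"

definition relax :: "string \<Rightarrow> string \<Rightarrow> com" where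
  "relax dst src = NSet ''r'' (NConst 0) ;; For ''S'' ''W'' (relax_step dst src)"

text \<open>Copying is relaxing with weight zero and the empty join code, since
  \<open>clear 0 S = S\<close>.\<close>

definition copy_table :: "string \<Rightarrow> string \<Rightarrow> com" where
  "copy_table dst src = (WAssign ''w'' (NConst 0) WZero ;; NSet ''p'' (NConst 0)) ;; relax dst src"

text \<open>The scratch table \<open>Z\<close> is needed because entries are updated in ascending
  order while smaller indices are read; updating in place would count the edge twice.\<close>

definition add_edge :: "string \<Rightarrow> nexp \<Rightarrow> com" where
  "add_edge a x =
     (WAssign ''w'' (NConst 0) (WRead ''weight'' (NSub x (NConst 1))) ;; NSet ''p'' (NRead ''pw'' x)) ;;
     relax ''Z'' a ;; copy_table a ''Z''"

lemma mods_relax [simp]: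
  "nmods (relax dst src) = {''r'', ''S''}" "wmods (relax dst src) = {dst}"
  by (auto simp: relax_def relax_step_def)

lemma mods_copy_table [simp]:
  "nmods (copy_table dst src) = {''r'', ''S'', ''p''}" "wmods (copy_table dst src) = {dst, ''w''}"
  by (auto simp: copy_table_def)

lemma mods_add_edge [simp]:
  "nmods (add_edge a x) = {''r'', ''S'', ''p''}" "wmods (add_edge a x) = {a, ''w'', ''Z''}"
  by (auto simp: add_edge_def)

lemma ok_relax:
  assumes W: "nmem s ''W'' 0 = W" and d: "dst \<noteq> src" "dst \<noteq> ''w''"
    and p: "p = nmem s ''p'' 0" and b: "(W + 1) * 100 + 3 \<le> b"
    and Q: "\<And>s'. agree_off {''r'', ''S''} {dst} s s' \<Longrightarrow>
      \<forall>S<W. wmem s' dst S = wmem s ''w'' 0 + wmem s src (clear p S) \<Longrightarrow> Q s'"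
  shows "ok (relax dst src) s b Q"
proof -
  let ?R = "\<lambda>s'. \<forall>S<W. wmem s' dst S = wmem s ''w'' 0 + wmem s src (clear p S)"
  have "ok (relax dst src) s ((W + 1) * 100 + 3) ?R"
    unfolding relax_def
  proof (rule ok_Seq_run[where bQ = "(W + 1) * 100"], goal_cases)
    case 3
    show ?case
    proof (rule ok_For[where N = W and B = 80 and C = 100 and
          Inv = "\<lambda>k s'. nmem s' ''r'' 0 = k mod (p + p) \<and>
            (\<forall>S<k. wmem s' dst S = wmem s ''w'' 0 + wmem s src (clear p S))"], goal_cases)
      case (6 i s1)
      note fr = agree_off_nmem[OF 6(2)] and wfr = agree_off_wmem[OF 6(2)]
      have 1: "nmem s1 ''p'' 0 = p" "wmem s1 ''w'' = wmem s ''w''" "wmem s1 src = wmem s src"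
        using fr wfr d p by (auto simp: relax_step_def)
      have c: "clear p i = (if p \<le> nmem s1 ''r'' 0 then i - p else i)"
        using 6(4) by (simp add: clear_def)
      show ?case
        using 6(3,4) 1 c
        by (intro ok_run) (auto simp: relax_step_def less_Suc_eq mod_Suc split: if_splits)
    qed (use W in \<open>auto simp: relax_step_def\<close>)
  qed auto
  then show ?thesis using b by (rule ok_frame) (use Q in simp)
qed

lemma ok_copy_table:
  assumes W: "nmem s ''W'' 0 = W" and d: "dst \<noteq> src" "dst \<noteq> ''w''" "src \<noteq> ''w''"
    and b: "(W + 1) * 100 + 20 \<le> b"
    and Q: "\<And>s'. agree_off {''r'', ''S'', ''p''} {dst, ''w''} s s' \<Longrightarrow>
      \<forall>S<W. wmem s' dst S = wmem s src S \<Longrightarrow> Q s'"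
  shows "ok (copy_table dst src) s b Q"
proof -
  let ?R = "\<lambda>s'. \<forall>S<W. wmem s' dst S = wmem s src S"
  have "ok (copy_table dst src) s ((W + 1) * 100 + 20) ?R"
    unfolding copy_table_def
    by (rule ok_Seq_run[where bQ = "(W + 1) * 100 + 3"]; (rule ok_relax[where W = W and p = 0])?)
      (use W d in auto)
  then show ?thesis using b by (rule ok_frame) (use Q in simp)
qed

lemma ok_add_edge:
  assumes W: "nmem s ''W'' 0 = W" and a: "a \<notin> {''w'', ''Z'', ''weight''}"
    and x: "ncost x \<le> 10" "nval x s = e"
    and b: "(W + 1) * 300 + 100 \<le> b"
    and Q: "\<And>s'. agree_off {''r'', ''S'', ''p''} {a, ''w'', ''Z''} s s' \<Longrightarrow>
      \<forall>S<W. wmem s' a S = wmem s ''weight'' (e - 1) + wmem s a (clear (nmem s ''pw'' e) S) \<Longrightarrow> Q s'"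
  shows "ok (add_edge a x) s b Q"
proof -
  let ?w = "wmem s ''weight'' (e - 1)" and ?p = "nmem s ''pw'' e"
  let ?R = "\<lambda>s'. \<forall>S<W. wmem s' a S = ?w + wmem s a (clear ?p S)"
  let ?s = "nupd ''p'' 0 ?p (wupd ''w'' 0 ?w s)"
  \<comment> \<open>Values of natural number expressions do not depend on the weight memory.\<close>
  have nv: "nval x (wupd ''w'' 0 ?w s) = nval x s" by (induction x) auto
  have run: "run (WAssign ''w'' (NConst 0) (WRead ''weight'' (NSub x (NConst 1))) ;;
      NSet ''p'' (NRead ''pw'' x)) s = ?s"
    using x nv by simp
  have "ok (add_edge a x) s ((W + 1) * 300 + 100) ?R"
    unfolding add_edge_def
  proof (rule ok_Seq_run[where bQ = "(W + 1) * 200 + 40"], goal_cases)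
    case 3
    show ?case unfolding run
    proof (rule ok_Seq[where bQ = "(W + 1) * 100 + 20" and bP = "(W + 1) * 100 + 3"])
      show "ok (relax ''Z'' a) ?s ((W + 1) * 100 + 3)
         (\<lambda>s1. \<forall>S<W. wmem s1 ''Z'' S = ?w + wmem s a (clear ?p S))"
        by (rule ok_relax[where W = W and p = ?p]) (use W a in auto)
    next
      fix s1 assume 1: "\<forall>S<W. wmem s1 ''Z'' S = ?w + wmem s a (clear ?p S)"
        and H: "agree_off (nmods (relax ''Z'' a)) (wmods (relax ''Z'' a)) ?s s1"
      have "nmem s1 ''W'' 0 = W" using W agree_off_nmem[OF H] by simp
      then show "ok (copy_table a ''Z'') s1 ((W + 1) * 100 + 20) ?R"
        by (rule ok_copy_table) (use a 1 in auto)
    qed simp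
  qed (use x in auto)
  then show ?thesis using b by (rule ok_frame) (use Q in simp)
qed

definition next_edge :: com where
  "next_edge = NSet ''f'' (NRead ''own'' (NRead ''right'' (NSub (NRead ''al'' (Var ''f'')) (NConst 1))))"

text \<open>Only the first return to \<open>e\<close> is recorded, as \<open>per\<close> must still
  be 0.\<close>

definition find_period :: com where
  "find_period = (NSet ''f'' (Var ''e'') ;; NSet ''per'' (NConst 0)) ;;
     For ''r1'' ''m'' (next_edge ;;
       Cond (BAnd (NEq (Var ''f'') (Var ''e'')) (NEq (Var ''per'') (NConst 0)))
         (NSet ''per'' (NAdd (Var ''r1'') (NConst 1))) Skip)"

definition block_step :: com where
  "block_step = add_edge ''A'' (Var ''f'') ;; add_edge ''B'' (NRead ''al'' (Var ''f'')) ;;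
     NAssign ''vis'' (Var ''f'') (NConst 1) ;; next_edge"

text \<open>An edge on no cycle is a block of length one, for which \<open>finish_block\<close>
  keeps only table \<open>A\<close>. In general \<open>A\<close> extends \<open>T\<close> by the
  block as it is in \<open>X\<close>, and \<open>B\<close> by the flipped block.\<close>

definition process_block :: com where
  "process_block =
     (NSet ''q'' (Var ''per'') ;; Cond (NEq (Var ''per'') (NConst 0)) (NSet ''q'' (NConst 1)) Skip ;;
      NSet ''f'' (Var ''e'')) ;;
     copy_table ''A'' ''T'' ;; copy_table ''B'' ''T'' ;; For ''r2'' ''q'' block_step"

definition merge_tables :: com where
  "merge_tables = For ''S'' ''W'' (Cond (WLe (WRead ''A'' (Var ''S'')) (WRead ''B'' (Var ''S'')))
     (WAssign ''T'' (Var ''S'') (WRead ''A'' (Var ''S'')))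
     (WAssign ''T'' (Var ''S'') (WRead ''B'' (Var ''S''))))"

definition finish_block :: com where
  "finish_block = Cond (NEq (Var ''per'') (NConst 0)) (copy_table ''T'' ''A'') merge_tables"

definition init_table :: com where
  "init_table = For ''S'' ''W'' (WAssign ''T'' (Var ''S'') WInf) ;; WAssign ''T'' (NConst 0) WZero"

definition fill_table :: com where
  "fill_table = init_table ;;
     For ''b'' ''n'' (NSet ''e'' (NRead ''own'' (Var ''b'')) ;;
       Cond (BAnd (BNot (NEq (Var ''e'') (NConst 0))) (NEq (NRead ''vis'' (Var ''e'')) (NConst 0)))
         (find_period ;; process_block ;; finish_block) Skip)"

lemma ok_merge_tables:
  assumes W: "nmem s ''W'' 0 = W"
  shows "ok merge_tables s ((W + 1) * 100)
    (\<lambda>s'. \<forall>S<W. wmem s' ''T'' S = min (wmem s ''A'' S) (wmem s ''B'' S))"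
  unfolding merge_tables_def
proof (rule ok_For[where N = W and B = 50 and C = 100 and
    Inv = "\<lambda>k s'. \<forall>S<k. wmem s' ''T'' S = min (wmem s ''A'' S) (wmem s ''B'' S)"], goal_cases)
  case (6 i s1)
  have "wmem s1 ''A'' = wmem s ''A''" "wmem s1 ''B'' = wmem s ''B''"
    using agree_off_wmem[OF 6(2)] by auto
  then show ?case using 6(3,4) by (intro ok_run) (auto simp: less_Suc_eq min_def)
qed (use W in auto)

lemma ok_init_table:
  assumes W: "nmem s ''W'' 0 = W"
  shows "ok init_table s ((W + 1) * 100 + 10) (\<lambda>s'. \<forall>S<W. wmem s' ''T'' S = (if S = 0 then 0 else \<infinity>))"
  unfolding init_table_def
proof (rule ok_Seq[where bQ = 3])
  show "ok (For ''S'' ''W'' (WAssign ''T'' (Var ''S'') WInf)) s ((W + 1) * 100)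
     (\<lambda>s'. \<forall>S<W. wmem s' ''T'' S = \<infinity>)"
    by (rule ok_For[where N = W and B = 50 and C = 100 and
          Inv = "\<lambda>k s'. \<forall>S<k. wmem s' ''T'' S = \<infinity>"])
      (use W in \<open>auto intro!: ok_run simp: less_Suc_eq\<close>)
qed (auto intro!: ok_run)

section \<open>Dynamic programming over the cycles of \<open>nx\<close>\<close>

locale dp = edges Ed L R al m + flips Ed L R al X nx
  for Ed L R al m X nx +
  fixes own :: "nat \<Rightarrow> nat" and n W :: nat and w :: "nat \<Rightarrow> ereal" and pw :: "nat \<Rightarrow> nat"
  assumes w: "e \<in> Ed \<Longrightarrow> 0 \<le> w e"
    and pw: "e \<in> Ed \<Longrightarrow> pw e = 0 \<or> (\<exists>j. pw e = 2 ^ j)"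
    and own: "own b \<noteq> 0 \<Longrightarrow> own b \<in> X" "e \<in> X \<Longrightarrow> own (R e) = e" "e \<in> X \<Longrightarrow> R e < n"
    and nx_own: "nx e = own (R (al e))"
begin

definition dp_arrays :: "store \<Rightarrow> bool" where
  "dp_arrays s \<longleftrightarrow> edge_arrays s \<and> nmem s ''own'' = own \<and> nmem s ''W'' 0 = W \<and> nmem s ''n'' 0 = n \<and>
     (\<forall>e\<in>Ed. nmem s ''pw'' e = pw e \<and> wmem s ''weight'' (e - 1) = w e)"

lemma dp_arrays_cong:
  assumes "agree_off Y Z s s'" "dp_arrays s"
    "{''m'', ''al'', ''left'', ''right'', ''own'', ''W'', ''n'', ''pw''} \<inter> Y = {}" "''weight'' \<notin> Z"
  shows "dp_arrays s'"
  using assms(2-4) agree_off_nmem[OF assms(1)] agree_off_wmem[OF assms(1)]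
  by (simp add: dp_arrays_def edge_arrays_def)

lemma dp_arrays_nupd:
  assumes "x \<notin> {''m'', ''al'', ''left'', ''right'', ''own'', ''W'', ''n'', ''pw''}" "dp_arrays s"
  shows "dp_arrays (nupd x i k s)"
proof (rule dp_arrays_cong[OF _ assms(2)])
  show "agree_off {x} {} s (nupd x i k s)" by (simp add: agree_off_def)
qed (use assms(1) in auto)

lemma run_next_edge:
  assumes "dp_arrays s" "nmem s ''f'' 0 \<in> X"
  shows "run next_edge s = nupd ''f'' 0 (nx (nmem s ''f'' 0)) s"
proof -
  let ?f = "nmem s ''f'' 0"
  have "al ?f \<in> Ed" using assms(2) XE al by auto
  then have "nmem s ''right'' (al ?f - Suc 0) = R (al ?f)" "nmem s ''al'' = al"
    using assms(1) by (auto simp: dp_arrays_def edge_arrays_def)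
  then show ?thesis using assms(1) by (simp add: next_edge_def dp_arrays_def nx_own)
qed

lemma card_X: "card X \<le> m"
  using card_mono[OF fin XE] card_Ed by simp

text \<open>Period 0 encodes that \<open>e\<close> lies on no cycle.\<close>

definition is_period :: "nat \<Rightarrow> nat \<Rightarrow> bool" where
  "is_period e p \<longleftrightarrow> p \<le> m \<and> (if p = 0 then \<not> cyclic e
     else (nx ^^ p) e = e \<and> inj_on (\<lambda>i. (nx ^^ i) e) {..<p})"

text \<open>A period is at most \<open>card X\<close>, hence at most \<open>m\<close>, so
  \<open>m\<close> rounds without return prove that there is no cycle. A first return is at most the
  period from \<open>period_le\<close>, from which injectivity is inherited.\<close>

lemma is_periodI:
  assumes e: "e \<in> X" and p: "p \<le> m"
    and "p = 0 \<and> (\<forall>i. 0 < i \<and> i \<le> m \<longrightarrow> (nx ^^ i) e \<noteq> e) \<or>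
      0 < p \<and> (nx ^^ p) e = e \<and> (\<forall>i. 0 < i \<and> i < p \<longrightarrow> (nx ^^ i) e \<noteq> e)"
  shows "is_period e p"
  using assms(3)
proof
  assume 0: "p = 0 \<and> (\<forall>i. 0 < i \<and> i \<le> m \<longrightarrow> (nx ^^ i) e \<noteq> e)"
  then have "\<not> cyclic e" using period_le[OF e] card_X by (meson le_trans)
  then show ?thesis using 0 by (simp add: is_period_def)
next
  assume 1: "0 < p \<and> (nx ^^ p) e = e \<and> (\<forall>i. 0 < i \<and> i < p \<longrightarrow> (nx ^^ i) e \<noteq> e)"
  then have "cyclic e" unfolding cyclic_def by auto
  then obtain p' where p': "0 < p'" "(nx ^^ p') e = e" "inj_on (\<lambda>i. (nx ^^ i) e) {..<p'}"
    using period_le[OF e] by auto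
  then have "p \<le> p'" using 1 by (meson not_le)
  then have "inj_on (\<lambda>i. (nx ^^ i) e) {..<p}" using p'(3) by (auto intro: inj_on_subset)
  then show ?thesis using 1 p by (simp add: is_period_def)
qed

lemma ok_find_period:
  assumes s: "dp_arrays s" and e: "nmem s ''e'' 0 = e" "e \<in> X"
  shows "ok find_period s ((m + 1) * 100 + 20) (\<lambda>s'. is_period e (nmem s' ''per'' 0))"
  unfolding find_period_def
proof (rule ok_Seq_run[where bQ = "(m + 1) * 100"], goal_cases)
  case 3
  let ?s = "nupd ''per'' 0 0 (nupd ''f'' 0 e s)"
  have run: "run (NSet ''f'' (Var ''e'') ;; NSet ''per'' (NConst 0)) s = ?s"
    using e by simp
  have ds: "dp_arrays ?s" using s by (intro dp_arrays_nupd) auto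
  show ?case unfolding run
  proof (rule ok_For[where N = m and B = 80 and C = 100 and
      Inv = "\<lambda>k s'. nmem s' ''f'' 0 = (nx ^^ k) e \<and>
        (nmem s' ''per'' 0 = 0 \<and> (\<forall>i. 0 < i \<and> i \<le> k \<longrightarrow> (nx ^^ i) e \<noteq> e) \<or>
         0 < nmem s' ''per'' 0 \<and> nmem s' ''per'' 0 \<le> k \<and> (nx ^^ nmem s' ''per'' 0) e = e \<and>
         (\<forall>i. 0 < i \<and> i < nmem s' ''per'' 0 \<longrightarrow> (nx ^^ i) e \<noteq> e))"], goal_cases)
    case (6 k s1)
    have d1: "dp_arrays s1"
      by (rule dp_arrays_cong[OF 6(2) ds]) (auto simp: next_edge_def)
    have "nmem s1 ''e'' = nmem ?s ''e''"
      by (rule agree_off_nmem[OF 6(2)]) (auto simp: next_edge_def)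
    then have e1: "nmem s1 ''e'' 0 = e" using e by simp
    have "nmem s1 ''f'' 0 \<in> X" using 6(4) funpow_X e by auto
    note nxt = run_next_edge[OF d1 this]
    have P: "(\<forall>i. 0 < i \<and> i \<le> Suc k \<longrightarrow> P i) \<longleftrightarrow> (\<forall>i. 0 < i \<and> i \<le> k \<longrightarrow> P i) \<and> P (Suc k)" for P
      by (auto simp: le_Suc_eq)
    have f: "nmem s1 ''f'' 0 = (nx ^^ k) e" using 6(4) by simp
    have "max_cost next_edge \<le> 20" "loop_free next_edge" by (auto simp: next_edge_def)
    then show ?case
      by (intro ok_run)
        (use 6(3,4) in \<open>auto simp: nxt e1 f P less_Suc_eq_le\<close>)
  next
    case (9 s')
    then show ?case using e by (intro is_periodI) auto
  qed (use s e in \<open>auto simp: next_edge_def dp_arrays_def edge_arrays_def\<close>)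
qed auto

definition orbit :: "nat \<Rightarrow> nat \<Rightarrow> nat set" where
  "orbit e k = (\<lambda>i. (nx ^^ i) e) ` {..<k}"

lemma orbit_Suc: "orbit e (Suc k) = insert ((nx ^^ k) e) (orbit e k)"
  by (simp add: orbit_def lessThan_Suc)

lemma orbit_X: "e \<in> X \<Longrightarrow> orbit e k \<subseteq> X"
  using funpow_X by (auto simp: orbit_def)

text \<open>Both claims are instances of \<open>best_insert\<close>. The edge added is new because
  its left end is: \<open>f\<close> and \<open>al f\<close> share it, and it occurs neither in
  \<open>fam V\<close> nor earlier in the orbit.\<close>

lemma best_orbit_step:
  assumes V: "V \<subseteq> X" and e: "e \<in> X" and f: "f = (nx ^^ k) e" "f \<notin> V" "f \<notin> orbit e k"
  shows "best w pw ((\<lambda>Y. Y \<union> orbit e (Suc k)) ` fam V) S =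
      w f + best w pw ((\<lambda>Y. Y \<union> orbit e k) ` fam V) (clear (pw f) S)" (is ?keep)
    and "best w pw ((\<lambda>Y. Y \<union> al ` orbit e (Suc k)) ` fam V) S =
      w (al f) + best w pw ((\<lambda>Y. Y \<union> al ` orbit e k) ` fam V) (clear (pw (al f)) S)" (is ?flip)
proof -
  have fX: "f \<in> X" using f funpow_X e by auto
  then have fE: "f \<in> Ed" "al f \<in> Ed" "L (al f) = L f" using XE al by auto
  have O: "orbit e k \<subseteq> X" "finite (orbit e k)" using orbit_X e by (auto simp: orbit_def)
  have fY: "L f \<notin> L ` Y" if "Y \<in> fam V" for Y using fam_fresh[OF V that fX] f by auto
  \<comment> \<open>\<open>al\<close> is injective on \<open>X\<close> because it preserves left
    ends.\<close>
  have nf: "al f \<notin> al ` orbit e k"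
  proof
    assume "al f \<in> al ` orbit e k"
    then obtain u where u: "al f = al u" "u \<in> orbit e k" by auto
    then have "L f = L u" using fE(3) al(2)[of u] O XE by (metis subsetD)
    then have "f = u" using pm_L[OF X fX] u O by auto
    then show False using u f by auto
  qed
  have eq: "(\<lambda>Y. Y \<union> orbit e (Suc k)) ` fam V = insert f ` (\<lambda>Y. Y \<union> orbit e k) ` fam V"
    "(\<lambda>Y. Y \<union> al ` orbit e (Suc k)) ` fam V = insert (al f) ` (\<lambda>Y. Y \<union> al ` orbit e k) ` fam V"
    by (auto simp: orbit_Suc f(1) image_image)
  show ?keep unfolding eq(1)
  proof (rule best_insert)
    fix Y' assume "Y' \<in> (\<lambda>Y. Y \<union> orbit e k) ` fam V"
    then obtain Y where Y: "Y' = Y \<union> orbit e k" "Y \<in> fam V" by auto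
    then have "Y' \<subseteq> Ed" "finite Y'" using fam_mem[OF V Y(2)] O XE by auto
    moreover have "f \<notin> Y'" using fY[OF Y(2)] f Y by auto
    ultimately show "finite Y' \<and> f \<notin> Y' \<and> (\<forall>e\<in>Y'. 0 \<le> w e)" using w by auto
  qed (use w pw fE in auto)
  show ?flip unfolding eq(2)
  proof (rule best_insert)
    fix Y' assume "Y' \<in> (\<lambda>Y. Y \<union> al ` orbit e k) ` fam V"
    then obtain Y where Y: "Y' = Y \<union> al ` orbit e k" "Y \<in> fam V" by auto
    then have "Y' \<subseteq> Ed" "finite Y'" using fam_mem[OF V Y(2)] O XE al by auto
    moreover have "al f \<notin> Y" using fY[OF Y(2)] fE(3) by (metis imageI)
    then have "al f \<notin> Y'" using nf Y by auto
    ultimately show "finite Y' \<and> al f \<notin> Y' \<and> (\<forall>e\<in>Y'. 0 \<le> w e)" using w by auto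
  qed (use w pw fE in auto)
qed

definition table :: "store \<Rightarrow> string \<Rightarrow> nat set set \<Rightarrow> bool" where
  "table s a \<F> \<longleftrightarrow> (\<forall>S<W. wmem s a S = best w pw \<F> S)"

lemma ok_block_step:
  assumes s: "dp_arrays s" and e: "e \<in> X" and V: "V \<subseteq> X"
    and f: "nmem s ''f'' 0 = (nx ^^ k) e" "(nx ^^ k) e \<notin> V" "(nx ^^ k) e \<notin> orbit e k"
    and A: "table s ''A'' ((\<lambda>Y. Y \<union> orbit e k) ` fam V)"
    and B: "table s ''B'' ((\<lambda>Y. Y \<union> al ` orbit e k) ` fam V)"
  shows "ok block_step s ((W + 1) * 900) (\<lambda>s'.
    table s' ''A'' ((\<lambda>Y. Y \<union> orbit e (Suc k)) ` fam V) \<and>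
    table s' ''B'' ((\<lambda>Y. Y \<union> al ` orbit e (Suc k)) ` fam V) \<and>
    nmem s' ''f'' 0 = (nx ^^ Suc k) e \<and> nmem s' ''vis'' = (nmem s ''vis'')((nx ^^ k) e := 1))"
  unfolding block_step_def
proof (rule ok_Seq[where bQ = "(W + 1) * 300 + 200" and bP = "(W + 1) * 300 + 100"])
  let ?f = "(nx ^^ k) e"
  have fX: "?f \<in> X" using funpow_X e by auto
  then have fE: "?f \<in> Ed" "al ?f \<in> Ed" using XE al by auto
  have W: "nmem s ''W'' 0 = W" using s by (simp add: dp_arrays_def)
  let ?A = "(\<lambda>Y. Y \<union> orbit e (Suc k)) ` fam V" and ?B = "(\<lambda>Y. Y \<union> al ` orbit e (Suc k)) ` fam V"
  note step = best_orbit_step[OF V e refl f(2,3)]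
  \<comment> \<open>Clearing a bit does not increase the index, so every lookup stays inside the
    table.\<close>
  have lt: "clear p S < W" if "S < W" for p S using clear_le[of p S] that by linarith
  show "ok (add_edge ''A'' (Var ''f'')) s ((W + 1) * 300 + 100) (\<lambda>s'. table s' ''A'' ?A)"
    by (rule ok_add_edge[where W = W and e = ?f])
      (use W f s fE A lt in \<open>auto simp: table_def step dp_arrays_def\<close>)
  fix s1 assume A1: "table s1 ''A'' ?A"
    and "agree_off (nmods (add_edge ''A'' (Var ''f''))) (wmods (add_edge ''A'' (Var ''f''))) s s1"
  then have H1: "agree_off {''r'', ''S'', ''p''} {''A'', ''w'', ''Z''} s s1" by simp
  have s1: "dp_arrays s1" by (rule dp_arrays_cong[OF H1 s]) auto
  have f1: "nmem s1 ''f'' 0 = ?f" "wmem s1 ''B'' = wmem s ''B''" "nmem s1 ''vis'' = nmem s ''vis''"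
    using agree_off_nmem[OF H1] agree_off_wmem[OF H1] f by auto
  have W1: "nmem s1 ''W'' 0 = W" "nmem s1 ''al'' = al" using s1 by (auto simp: dp_arrays_def edge_arrays_def)
  show "ok (add_edge ''B'' (NRead ''al'' (Var ''f'')) ;; NAssign ''vis'' (Var ''f'') (NConst 1) ;; next_edge) s1
     ((W + 1) * 300 + 200) (\<lambda>s'. table s' ''A'' ?A \<and> table s' ''B'' ?B \<and>
       nmem s' ''f'' 0 = (nx ^^ Suc k) e \<and> nmem s' ''vis'' = (nmem s ''vis'')(?f := 1))"
  proof (rule ok_Seq[where bQ = 50 and bP = "(W + 1) * 300 + 100"])
    show "ok (add_edge ''B'' (NRead ''al'' (Var ''f''))) s1 ((W + 1) * 300 + 100) (\<lambda>s'. table s' ''B'' ?B)"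
      by (rule ok_add_edge[where W = W and e = "al ?f"])
        (use W1 f1 s1 fE B lt in \<open>auto simp: table_def step dp_arrays_def\<close>)
    fix s2 assume B2: "table s2 ''B'' ?B"
      and "agree_off (nmods (add_edge ''B'' (NRead ''al'' (Var ''f''))))
             (wmods (add_edge ''B'' (NRead ''al'' (Var ''f'')))) s1 s2"
    then have H2: "agree_off {''r'', ''S'', ''p''} {''B'', ''w'', ''Z''} s1 s2" by simp
    have s2: "dp_arrays s2" by (rule dp_arrays_cong[OF H2 s1]) auto
    have f2: "nmem s2 ''f'' 0 = ?f" "wmem s2 ''A'' = wmem s1 ''A''" "nmem s2 ''vis'' = nmem s ''vis''"
      using agree_off_nmem[OF H2] agree_off_wmem[OF H2] f1 by auto
    have d3: "dp_arrays (nupd ''vis'' ?f 1 s2)" using s2 by (intro dp_arrays_nupd) auto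
    have nxt: "run next_edge (nupd ''vis'' ?f (Suc 0) s2) = nupd ''f'' 0 (nx ?f) (nupd ''vis'' ?f (Suc 0) s2)"
      using run_next_edge[OF d3] f2 fX by simp
    have "max_cost next_edge \<le> 20" "loop_free next_edge" by (auto simp: next_edge_def)
    then show "ok (NAssign ''vis'' (Var ''f'') (NConst 1) ;; next_edge) s2 50 (\<lambda>s'. table s' ''A'' ?A \<and> table s' ''B'' ?B \<and>
       nmem s' ''f'' 0 = (nx ^^ Suc k) e \<and> nmem s' ''vis'' = (nmem s ''vis'')(?f := 1))"
      using A1 B2 f2 by (intro ok_run) (auto simp: nxt table_def)
  qed simp
qed simp

lemma ok_process_block:
  assumes s: "dp_arrays s" and e: "nmem s ''e'' 0 = e" "e \<in> X"
    and per: "nmem s ''per'' 0 \<le> m" and k: "k = (if nmem s ''per'' 0 = 0 then 1 else nmem s ''per'' 0)"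
    and V: "V \<subseteq> X" "orbit e k \<inter> V = {}" "inj_on (\<lambda>i. (nx ^^ i) e) {..<k}"
    and T: "table s ''T'' (fam V)"
  shows "ok process_block s ((m + 3) * ((W + 1) * 1000)) (\<lambda>s'.
    table s' ''A'' ((\<lambda>Y. Y \<union> orbit e k) ` fam V) \<and>
    table s' ''B'' ((\<lambda>Y. Y \<union> al ` orbit e k) ` fam V) \<and>
    {x. nmem s' ''vis'' x \<noteq> 0} = {x. nmem s ''vis'' x \<noteq> 0} \<union> orbit e k)"
  unfolding process_block_def
proof (rule ok_Seq_run[where bQ = "2 * ((W + 1) * 100 + 20) + (m + 2) * ((W + 1) * 1000)"], goal_cases)
  case 3
  let ?s = "nupd ''f'' 0 e (nupd ''q'' 0 k s)"
  let ?Q = "\<lambda>s'. table s' ''A'' ((\<lambda>Y. Y \<union> orbit e k) ` fam V) \<and>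
    table s' ''B'' ((\<lambda>Y. Y \<union> al ` orbit e k) ` fam V) \<and>
    {x. nmem s' ''vis'' x \<noteq> 0} = {x. nmem s ''vis'' x \<noteq> 0} \<union> orbit e k"
  have "run (NSet ''q'' (Var ''per'') ;; Cond (NEq (Var ''per'') (NConst 0)) (NSet ''q'' (NConst 1)) Skip ;;
      NSet ''f'' (Var ''e'')) s = ?s"
    using e k by (auto simp: nupd_def)
  note run = this
  have ds: "dp_arrays ?s" using s by (intro dp_arrays_nupd) auto
  have W: "nmem ?s ''W'' 0 = W" using ds by (simp add: dp_arrays_def)
  show ?case unfolding run
  proof (rule ok_Seq[where bP = "(W + 1) * 100 + 20" and bQ = "(W + 1) * 100 + 20 + (m + 2) * ((W + 1) * 1000)"])
    show "ok (copy_table ''A'' ''T'') ?s ((W + 1) * 100 + 20) (\<lambda>s1. table s1 ''A'' (fam V))"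
      by (rule ok_copy_table[OF W]) (use T in \<open>auto simp: table_def\<close>)
    fix s1 assume A1: "table s1 ''A'' (fam V)"
      and "agree_off (nmods (copy_table ''A'' ''T'')) (wmods (copy_table ''A'' ''T'')) ?s s1"
    then have H1: "agree_off {''r'', ''S'', ''p''} {''A'', ''w''} ?s s1" by simp
    have s1: "dp_arrays s1" by (rule dp_arrays_cong[OF H1 ds]) auto
    then have W1: "nmem s1 ''W'' 0 = W" by (simp add: dp_arrays_def)
    have T1: "wmem s1 ''T'' = wmem s ''T''" using agree_off_wmem[OF H1] by auto
    show "ok (copy_table ''B'' ''T'' ;; For ''r2'' ''q'' block_step) s1
        ((W + 1) * 100 + 20 + (m + 2) * ((W + 1) * 1000)) ?Q"
    proof (rule ok_Seq[where bP = "(W + 1) * 100 + 20" and bQ = "(m + 2) * ((W + 1) * 1000)"])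
      show "ok (copy_table ''B'' ''T'') s1 ((W + 1) * 100 + 20) (\<lambda>s1. table s1 ''B'' (fam V))"
        by (rule ok_copy_table[OF W1]) (use T T1 in \<open>auto simp: table_def\<close>)
      fix s2 assume B2: "table s2 ''B'' (fam V)"
        and "agree_off (nmods (copy_table ''B'' ''T'')) (wmods (copy_table ''B'' ''T'')) s1 s2"
      then have H2: "agree_off {''r'', ''S'', ''p''} {''B'', ''w''} s1 s2" by simp
      have s2: "dp_arrays s2" by (rule dp_arrays_cong[OF H2 s1]) auto
      have A2: "table s2 ''A'' (fam V)" using A1 agree_off_wmem[OF H2] by (simp add: table_def)
      have f2: "nmem s2 ''f'' 0 = e" "nmem s2 ''q'' 0 = k" "nmem s2 ''vis'' = nmem s ''vis''"
        using agree_off_nmem[OF H2] agree_off_nmem[OF H1] by auto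
      show "ok (For ''r2'' ''q'' block_step) s2 ((m + 2) * ((W + 1) * 1000)) ?Q"
      proof (rule ok_For[where N = k and B = "(W + 1) * 900" and C = "(W + 1) * 1000" and
          Inv = "\<lambda>k s'. table s' ''A'' ((\<lambda>Y. Y \<union> orbit e k) ` fam V) \<and>
            table s' ''B'' ((\<lambda>Y. Y \<union> al ` orbit e k) ` fam V) \<and> nmem s' ''f'' 0 = (nx ^^ k) e \<and>
            {x. nmem s' ''vis'' x \<noteq> 0} = {x. nmem s ''vis'' x \<noteq> 0} \<union> orbit e k"], goal_cases)
        case (6 i s3)
        have s3: "dp_arrays s3"
          by (rule dp_arrays_cong[OF 6(2) s2]) (auto simp: block_step_def next_edge_def)
        have "(nx ^^ i) e \<in> orbit e k" using 6(1) by (auto simp: orbit_def)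
        then have nV: "(nx ^^ i) e \<notin> V" using V by auto
        have nO: "(nx ^^ i) e \<notin> orbit e i"
        proof
          assume "(nx ^^ i) e \<in> orbit e i"
          then obtain j where "j < i" "(nx ^^ i) e = (nx ^^ j) e" by (auto simp: orbit_def)
          then show False using inj_onD[OF V(3), of i j] 6(1) by auto
        qed
        show ?case
        proof (rule ok_mono[OF ok_block_step[OF s3 e(2) V(1) _ nV nO]], goal_cases)
          case (5 s')
          have "{x. ((nmem s3 ''vis'')((nx ^^ i) e := 1)) x \<noteq> 0} = insert ((nx ^^ i) e) {x. nmem s3 ''vis'' x \<noteq> 0}"
            by auto
          then show ?case using 5 6(4) by (auto simp: table_def orbit_Suc)
        qed (use 6(4) in auto)
      next
        case 8
        \<comment> \<open>Here \<open>k \<le> m + 1\<close>, including period 0 where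
          \<open>k = 1\<close>.\<close>
        show ?case using per k by (intro mult_le_mono1) auto
      qed (use f2 A2 B2 in \<open>auto simp: block_step_def next_edge_def orbit_def table_def\<close>)
    qed simp
  qed simp
next
  case 2
  show ?case by (simp add: algebra_simps)
qed auto

lemma ok_finish_block:
  assumes W: "nmem s ''W'' 0 = W" and A: "table s ''A'' \<F>" and B: "table s ''B'' \<G>"
  shows "ok finish_block s ((W + 1) * 100 + 40)
    (\<lambda>s'. table s' ''T'' (if nmem s ''per'' 0 = 0 then \<F> else \<F> \<union> \<G>))"
  unfolding finish_block_def
proof (rule ok_Cond[where bP = "(W + 1) * 100 + 20"], goal_cases)
  case 1
  then show ?case
    by (intro ok_copy_table[OF W]) (use A in \<open>auto simp: table_def\<close>)
next
  case 2
  then show ?case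
    by (intro ok_mono[OF ok_merge_tables[OF W]]) (use A B in \<open>auto simp: table_def best_Un\<close>)
qed simp

definition fill_inv :: "store \<Rightarrow> bool" where
  "fill_inv s \<longleftrightarrow> cyc_closed {x. nmem s ''vis'' x \<noteq> 0} \<and> table s ''T'' (fam {x. nmem s ''vis'' x \<noteq> 0})"

lemma ok_block:
  assumes s: "dp_arrays s" and e: "nmem s ''e'' 0 = e" "e \<in> X" "nmem s ''vis'' e = 0"
    and inv: "fill_inv s"
  shows "ok (find_period ;; process_block ;; finish_block) s ((m + 4) * ((W + 1) * 1200))
    (\<lambda>s'. fill_inv s' \<and> insert e {x. nmem s ''vis'' x \<noteq> 0} \<subseteq> {x. nmem s' ''vis'' x \<noteq> 0})"
proof (rule ok_Seq[OF ok_find_period[OF s e(1,2)]])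
  let ?V = "{x. nmem s ''vis'' x \<noteq> 0}"
  have V: "cyc_closed ?V" "e \<notin> ?V" "?V \<subseteq> X" using inv e by (auto simp: fill_inv_def cyc_closed_def)
  fix s1 assume per: "is_period e (nmem s1 ''per'' 0)"
    and H: "agree_off (nmods find_period) (wmods find_period) s s1"
  have s1: "dp_arrays s1" by (rule dp_arrays_cong[OF H s]) (auto simp: find_period_def next_edge_def)
  have "nmem s1 ''e'' = nmem s ''e''" "nmem s1 ''vis'' = nmem s ''vis''" "wmem s1 ''T'' = wmem s ''T''"
    using agree_off_nmem[OF H] agree_off_wmem[OF H] by (auto simp: find_period_def next_edge_def)
  then have e1: "nmem s1 ''e'' 0 = e" and vis1: "nmem s1 ''vis'' = nmem s ''vis''" and T1: "table s1 ''T'' (fam ?V)"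
    using e inv by (auto simp: fill_inv_def table_def)
  let ?p = "nmem s1 ''per'' 0"
  define k where "k = (if ?p = 0 then 1 else ?p)"
  have O1: "orbit e 1 = {e}" by (auto simp: orbit_def)
  \<comment> \<open>An acyclic edge is its own orbit of length one, so both cases meet the
    requirements of \<open>ok_process_block\<close>; they differ only in whether the flipped family
    joins in.\<close>
  have "orbit e k \<inter> ?V = {} \<and> inj_on (\<lambda>i. (nx ^^ i) e) {..<k} \<and> cyc_closed (?V \<union> orbit e k) \<and>
     fam (?V \<union> orbit e k) = (if ?p = 0 then (\<lambda>Y. Y \<union> orbit e k) ` fam ?V
       else (\<lambda>Y. Y \<union> orbit e k) ` fam ?V \<union> (\<lambda>Y. Y \<union> al ` orbit e k) ` fam ?V)"
  proof (cases "?p = 0")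
    case True
    then have "\<not> cyclic e" using per by (simp add: is_period_def)
    from fam_acyclic[OF V(1) e(2) V(2) this] True
    show ?thesis
      using e(3) O1 unfolding k_def by (simp add: inj_on_def)
  next
    case False
    then have p: "0 < ?p" "(nx ^^ ?p) e = e" "inj_on (\<lambda>i. (nx ^^ i) e) {..<?p}"
      using per by (auto simp: is_period_def)
    from fam_cyclic[OF V(1) e(2) V(2) p(1,2) orbit_def] False p(3)
    show ?thesis
      unfolding k_def by simp
  qed
  note fam = this[THEN conjunct1] this[THEN conjunct2, THEN conjunct1]
    this[THEN conjunct2, THEN conjunct2, THEN conjunct1]
    this[THEN conjunct2, THEN conjunct2, THEN conjunct2]
  have eO: "e \<in> orbit e k" unfolding orbit_def k_def by (auto intro!: image_eqI[of _ _ 0])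
  show "ok (process_block ;; finish_block) s1 ((m + 3) * ((W + 1) * 1000) + ((W + 1) * 100 + 40))
    (\<lambda>s'. fill_inv s' \<and> insert e ?V \<subseteq> {x. nmem s' ''vis'' x \<noteq> 0})"
  proof (rule ok_Seq[OF ok_process_block[OF s1 e1 e(2) _ k_def V(3) fam(1,2) T1]])
    show "?p \<le> m" using per by (simp add: is_period_def)
  next
    fix s2 assume 2: "table s2 ''A'' ((\<lambda>Y. Y \<union> orbit e k) ` fam ?V) \<and>
       table s2 ''B'' ((\<lambda>Y. Y \<union> al ` orbit e k) ` fam ?V) \<and>
       {x. nmem s2 ''vis'' x \<noteq> 0} = {x. nmem s1 ''vis'' x \<noteq> 0} \<union> orbit e k"
      and H2: "agree_off (nmods process_block) (wmods process_block) s1 s2"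
    have s2: "dp_arrays s2"
      by (rule dp_arrays_cong[OF H2 s1]) (auto simp: process_block_def block_step_def next_edge_def)
    have per2: "nmem s2 ''per'' = nmem s1 ''per''"
      by (rule agree_off_nmem[OF H2]) (auto simp: process_block_def block_step_def next_edge_def)
    have W2: "nmem s2 ''W'' 0 = W" using s2 by (simp add: dp_arrays_def)
    show "ok finish_block s2 ((W + 1) * 100 + 40)
      (\<lambda>s'. fill_inv s' \<and> insert e ?V \<subseteq> {x. nmem s' ''vis'' x \<noteq> 0})"
    proof (rule ok_frame[OF ok_finish_block[OF W2]])
      show "table s2 ''A'' ((\<lambda>Y. Y \<union> orbit e k) ` fam ?V)"
        "table s2 ''B'' ((\<lambda>Y. Y \<union> al ` orbit e k) ` fam ?V)" using 2 by auto
      fix s3 assume T3: "table s3 ''T'' (if nmem s2 ''per'' 0 = 0 then (\<lambda>Y. Y \<union> orbit e k) ` fam ?V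
         else (\<lambda>Y. Y \<union> orbit e k) ` fam ?V \<union> (\<lambda>Y. Y \<union> al ` orbit e k) ` fam ?V)"
        and H3: "agree_off (nmods finish_block) (wmods finish_block) s2 s3"
      have "nmem s3 ''vis'' = nmem s2 ''vis''"
        by (rule agree_off_nmem[OF H3]) (auto simp: finish_block_def merge_tables_def)
      then have "{x. nmem s3 ''vis'' x \<noteq> 0} = ?V \<union> orbit e k" using 2 vis1 by simp
      then show "fill_inv s3 \<and> insert e ?V \<subseteq> {x. nmem s3 ''vis'' x \<noteq> 0}"
        using T3 fam(3,4) eO per2 unfolding fill_inv_def by auto
    qed simp
  qed simp
next
  show "(m + 1) * 100 + 20 + ((m + 3) * ((W + 1) * 1000) + ((W + 1) * 100 + 40)) \<le> (m + 4) * ((W + 1) * 1200)"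
    by (simp add: algebra_simps)
qed

text \<open>When all right vertices have been scanned, every edge of \<open>X\<close> is visited and
  \<open>fam_all\<close> applies. The bound charges each of the \<open>n\<close> rounds for a cycle
  of up to \<open>m\<close> edges, without amortising over the cycles; this is the origin of the
  term \<open>n^2 2^c\<close>.\<close>

lemma ok_fill_table:
  assumes s: "dp_arrays s" and vis: "nmem s ''vis'' = (\<lambda>_. 0)"
  shows "ok fill_table s ((n + 2) * ((m + 4) * ((W + 1) * 1300))) (\<lambda>s'. table s' ''T'' {Y. pm Y})"
  unfolding fill_table_def
proof (rule ok_Seq[OF ok_init_table])
  show "nmem s ''W'' 0 = W" using s by (simp add: dp_arrays_def)
  let ?body = "NSet ''e'' (NRead ''own'' (Var ''b'')) ;;
       Cond (BAnd (BNot (NEq (Var ''e'') (NConst 0))) (NEq (NRead ''vis'' (Var ''e'')) (NConst 0)))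
         (find_period ;; process_block ;; finish_block) Skip"
  have mods: "nmods (For ''b'' ''n'' ?body) \<inter>
      {''m'', ''al'', ''left'', ''right'', ''own'', ''W'', ''n'', ''pw''} = {}"
    "''weight'' \<notin> wmods (For ''b'' ''n'' ?body)"
    by (auto simp: find_period_def process_block_def finish_block_def merge_tables_def
        block_step_def next_edge_def)
  fix s1 assume T1: "\<forall>S<W. wmem s1 ''T'' S = (if S = 0 then 0 else \<infinity>)"
    and H1: "agree_off (nmods init_table) (wmods init_table) s s1"
  have s1: "dp_arrays s1" by (rule dp_arrays_cong[OF H1 s]) (auto simp: init_table_def)
  have vis1: "nmem s1 ''vis'' = (\<lambda>_. 0)"
    using agree_off_nmem[OF H1] vis by (simp add: init_table_def)
  have inv1: "fill_inv s1"
    using T1 by (simp add: fill_inv_def vis1 cyc_closed_def fam_empty table_def best_init)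
  show "ok (For ''b'' ''n'' ?body) s1 ((n + 1) * ((m + 4) * ((W + 1) * 1300)))
     (\<lambda>s'. table s' ''T'' {Y. pm Y})"
  proof (rule ok_For[where N = n and B = "(m + 4) * ((W + 1) * 1200) + 100" and
        C = "(m + 4) * ((W + 1) * 1300)" and
        Inv = "\<lambda>k s'. fill_inv s' \<and> (\<forall>b<k. own b \<noteq> 0 \<longrightarrow> nmem s' ''vis'' (own b) \<noteq> 0)"], goal_cases)
    case (6 i s2)
    have s2: "dp_arrays s2" by (rule dp_arrays_cong[OF 6(2) s1]) (use mods in auto)
    let ?s = "nupd ''e'' 0 (own i) s2"
    have s3: "dp_arrays ?s" using s2 by (intro dp_arrays_nupd) auto
    show ?case
    proof (rule ok_Seq_run[where bQ = "(m + 4) * ((W + 1) * 1200) + 50"], goal_cases)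
      case 3
      have run: "run (NSet ''e'' (NRead ''own'' (Var ''b''))) s2 = ?s"
        using 6(3) s2 by (simp add: dp_arrays_def)
      show ?case unfolding run
      proof (rule ok_Cond[where bP = "(m + 4) * ((W + 1) * 1200)"], goal_cases)
        case 1
        then have e: "own i \<noteq> 0" "nmem s2 ''vis'' (own i) = 0" by auto
        have "fill_inv ?s" using 6(4) by (simp add: fill_inv_def table_def)
        then show ?case
          by (intro ok_mono[OF ok_block[OF s3, where e = "own i"]])
            (use e own(1) 6(4) in \<open>auto simp: less_Suc_eq fill_inv_def table_def subset_iff\<close>)
      next
        case 2
        then show ?case using 6(4)
          by (intro ok_run) (auto simp: less_Suc_eq fill_inv_def table_def)
      qed simp
    qed auto
  next
    case (9 s')
    let ?V = "{x. nmem s' ''vis'' x \<noteq> 0}"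
    have "?V \<subseteq> X" using 9 by (simp add: fill_inv_def cyc_closed_def)
    moreover have "X \<subseteq> ?V"
    proof
      fix x assume x: "x \<in> X"
      then have "own (R x) = x" "R x < n" using own by auto
      moreover have "x \<noteq> 0" using x XE zero(1) by (metis subsetD)
      ultimately show "x \<in> ?V" using 9(2) by auto
    qed
    ultimately have "?V = X" by auto
    then show ?case using 9(2) fam_all by (simp add: fill_inv_def)
  next
    case 5
    show ?case using inv1 by (auto simp: fill_inv_def table_def)
  next
    case 7
    show ?case by (simp add: algebra_simps)
  qed (use s1 mods in \<open>auto simp: dp_arrays_def find_period_def process_block_def finish_block_def
      merge_tables_def block_step_def next_edge_def\<close>)
next
  show "(W + 1) * 100 + 10 + (n + 1) * ((m + 4) * ((W + 1) * 1300)) \<le> (n + 2) * ((m + 4) * ((W + 1) * 1300))"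
    by (simp add: algebra_simps)
qed

end

section \<open>Encoded instances\<close>

locale encoded =
  fixes I :: cbm and vs :: "nat list" and es js :: "(nat \<times> nat) list"
  assumes inst: "cbm_instance I" and deg: "\<forall>v\<in>V1 I. degree I v \<le> 2"
    and vs: "distinct vs" "set vs = verts I"
    and es: "distinct es" "set es = {(a, b). a < length vs \<and> b < length vs \<and>
          vs ! a \<in> V1 I \<and> vs ! b \<in> V2 I \<and> {vs ! a, vs ! b} \<in> E I}"
    and js: "distinct js" "set js = {(i, j). i < j \<and> {i, j} \<in> joins I}"
begin

abbreviation "n \<equiv> length vs"
abbreviation "m \<equiv> length es"
abbreviation "c \<equiv> length js"
abbreviation "s0 \<equiv> input_store I vs es js"

definition Ed :: "nat set" where "Ed = {1..m}"
definition L :: "nat \<Rightarrow> nat" where "L e = fst (es ! (e - 1))"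
definition R :: "nat \<Rightarrow> nat" where "R e = snd (es ! (e - 1))"
definition edge :: "nat \<Rightarrow> nat set" where "edge e = {vs ! L e, vs ! R e}"
definition jn :: "nat \<Rightarrow> nat set" where "jn e = {j. j < c \<and> join_of s0 (e - 1) j}"

lemma Ed_mem:
  assumes "e \<in> Ed"
  shows "L e < n" "R e < n" "vs ! L e \<in> V1 I" "vs ! R e \<in> V2 I" "edge e \<in> E I" "e - 1 < m"
proof -
  have m: "e - 1 < m" using assms by (auto simp: Ed_def)
  then have "es ! (e - 1) \<in> set es" by simp
  then have "(L e, R e) \<in> set es" by (simp add: L_def R_def)
  then show "L e < n" "R e < n" "vs ! L e \<in> V1 I" "vs ! R e \<in> V2 I" "edge e \<in> E I"
    unfolding es(2) edge_def by auto
  show "e - 1 < m" by (fact m)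
qed

lemma V_disjoint: "V1 I \<inter> V2 I = {}"
  using inst by (simp add: cbm_instance_def)

lemma nth_vs_eq: "a < n \<Longrightarrow> b < n \<Longrightarrow> vs ! a = vs ! b \<longleftrightarrow> a = b"
  using vs(1) by (simp add: nth_eq_iff_index_eq)

lemma L_neq_R: "e \<in> Ed \<Longrightarrow> e' \<in> Ed \<Longrightarrow> L e \<noteq> R e'"
  using Ed_mem V_disjoint by (metis disjoint_iff)

lemma edge_eqD:
  assumes "e \<in> Ed" "e' \<in> Ed" "L e = L e'" "R e = R e'" shows "e = e'"
proof -
  have "es ! (e - 1) = es ! (e' - 1)" using assms(3,4) by (simp add: L_def R_def prod_eq_iff)
  then have "e - 1 = e' - 1" using es(1) Ed_mem(6) assms by (simp add: nth_eq_iff_index_eq)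
  then show ?thesis using assms(1,2) by (auto simp: Ed_def)
qed

lemma edge_Int:
  assumes "e \<in> Ed" "e' \<in> Ed"
  shows "edge e \<inter> edge e' = {} \<longleftrightarrow> L e \<noteq> L e' \<and> R e \<noteq> R e'"
proof -
  have "vs ! L e \<noteq> vs ! R e'" "vs ! R e \<noteq> vs ! L e'"
    using L_neq_R assms Ed_mem nth_vs_eq by metis+
  then show ?thesis unfolding edge_def using nth_vs_eq Ed_mem assms by auto
qed

lemma inj_edge: "inj_on edge Ed"
proof (rule inj_onI)
  fix e e' assume e: "e \<in> Ed" "e' \<in> Ed" and eq: "edge e = edge e'"
  have "vs ! L e \<noteq> vs ! R e'" "vs ! R e \<noteq> vs ! L e'"
    using L_neq_R e Ed_mem nth_vs_eq by metis+
  then have "vs ! L e = vs ! L e'" "vs ! R e = vs ! R e'"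
    using eq unfolding edge_def doubleton_eq_iff by metis+
  then have "L e = L e'" "R e = R e'"
    using nth_vs_eq[of "L e" "L e'"] nth_vs_eq[of "R e" "R e'"] Ed_mem(1,2)[OF e(1)] Ed_mem(1,2)[OF e(2)]
    by simp_all
  then show "e = e'" by (rule edge_eqD[OF e])
qed

lemma edge_image: "edge ` Ed = E I"
proof
  show "edge ` Ed \<subseteq> E I" using Ed_mem by auto
  show "E I \<subseteq> edge ` Ed"
  proof
    fix x assume x: "x \<in> E I"
    then obtain u v where uv: "x = {u, v}" "u \<in> V1 I" "v \<in> V2 I"
      using inst unfolding cbm_instance_def by blast
    then have "u \<in> set vs" "v \<in> set vs" by (auto simp: vs verts_def)
    then obtain a b where ab: "a < n" "b < n" "vs ! a = u" "vs ! b = v" by (metis in_set_conv_nth)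
    then have "(a, b) \<in> set es" using uv x unfolding es(2) by auto
    then obtain i where i: "i < m" "es ! i = (a, b)" by (metis in_set_conv_nth)
    then have "edge (Suc i) = x" "Suc i \<in> Ed" using ab uv by (auto simp: edge_def L_def R_def Ed_def)
    then show "x \<in> edge ` Ed" by blast
  qed
qed

text \<open>Three distinct edge numbers with a common left end would be three distinct edges at one
  vertex of \<open>V1 I\<close>.\<close>

lemma edges_at_two:
  assumes "x \<in> Ed" "y \<in> Ed" "z \<in> Ed" "L x = L y" "L x = L z" "x \<noteq> y" "x \<noteq> z"
  shows "y = z"
proof (rule ccontr)
  assume yz: "y \<noteq> z"
  let ?v = "vs ! L x"
  have "finite (E I)" unfolding edge_image[symmetric] by (simp add: Ed_def)
  then have fin: "finite {e \<in> E I. ?v \<in> e}" by simp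
  have sub: "{edge x, edge y, edge z} \<subseteq> {e \<in> E I. ?v \<in> e}"
    using assms(1-5) Ed_mem(5)
    by (simp add: edge_def[of x] edge_def[of y] edge_def[of z]) (metis edge_def)
  have "card {edge x, edge y, edge z} = 3"
    using inj_onD[OF inj_edge] assms yz by (auto simp: card_insert_if)
  then have "3 \<le> degree I ?v" unfolding degree_def using card_mono[OF fin sub] by simp
  moreover have "degree I ?v \<le> 2" using deg Ed_mem(3)[OF assms(1)] by auto
  ultimately show False by simp
qed

text \<open>The edges are sorted by left end; each of the at most \<open>n\<close> classes has at
  most two members.\<close>

lemma m_le: "m \<le> 2 * n"
proof -
  have fib: "card {e \<in> Ed. L e = v} \<le> 2" for v
  proof (rule ccontr)
    assume "\<not> card {e \<in> Ed. L e = v} \<le> 2"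
    then have "3 \<le> card {e \<in> Ed. L e = v}" by simp
    then obtain T where "T \<subseteq> {e \<in> Ed. L e = v}" "card T = 3"
      by (meson obtain_subset_with_card_n)
    then obtain x y z where "{x, y, z} \<subseteq> {e \<in> Ed. L e = v}" "x \<noteq> y" "y \<noteq> z" "x \<noteq> z"
      by (metis card_3_iff)
    then show False using edges_at_two[of x y z] by auto
  qed
  have "Ed = (\<Union>v<n. {e \<in> Ed. L e = v})" using Ed_mem by auto
  then have "card Ed = card (\<Union>v<n. {e \<in> Ed. L e = v})" by (rule arg_cong)
  also have "\<dots> \<le> (\<Sum>v<n. card {e \<in> Ed. L e = v})" by (rule card_UN_le) simp
  also have "\<dots> \<le> (\<Sum>v<n. 2)" by (intro sum_mono fib)
  finally show ?thesis by (simp add: Ed_def)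
qed

lemma card_verts: "card (verts I) = n"
  using vs distinct_card by metis

lemma joins_doubleton:
  assumes "x \<in> joins I" obtains i j where "x = {i, j}" "1 \<le> i" "i < j" "j \<le> parts I"
  using inst assms unfolding cbm_instance_def by blast

lemma card_joins: "card (joins I) = c"
proof -
  have "(\<lambda>(i, j). {i, j}) ` set js = joins I"
  proof
    show "joins I \<subseteq> (\<lambda>(i, j). {i, j}) ` set js"
      using joins_doubleton unfolding js(2) by (metis (mono_tags, lifting) case_prodI image_eqI mem_Collect_eq split_conv subsetI)
  qed (auto simp: js)
  moreover have "inj_on (\<lambda>(i, j). {i, j}) (set js)"
    unfolding js(2) by (auto simp: inj_on_def doubleton_eq_iff)
  ultimately show ?thesis using card_image distinct_card[OF js(1)] by metis
qed

lemma cell_iff: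
  assumes "v \<in> verts I" "i \<in> {1..parts I}"
  shows "v \<in> cell I i \<longleftrightarrow> cell_index I v = i"
proof -
  have inj: "inj_on (cell I) {1..parts I}" and part: "partition_on (verts I) (cell I ` {1..parts I})"
    using inst by (auto simp: cbm_instance_def)
  have uniq: "i = j" if "i \<in> {1..parts I}" "j \<in> {1..parts I}" "v \<in> cell I i" "v \<in> cell I j" for i j
  proof (rule ccontr)
    assume "i \<noteq> j"
    then have "cell I i \<noteq> cell I j" using inj that by (auto dest: inj_onD)
    then have "cell I i \<inter> cell I j = {}"
      using partition_onD2[OF part] that by (auto simp: disjoint_def)
    then show False using that by auto
  qed
  obtain k where k: "k \<in> {1..parts I}" "v \<in> cell I k"
    using assms(1) partition_onD1[OF part] by auto
  then have "cell_index I v = k" unfolding cell_index_def using uniq by (intro the_equality) auto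
  then show ?thesis using uniq k assms(2) by metis
qed

lemma s0_simps:
  "nmem s0 ''n'' 0 = n" "nmem s0 ''m'' 0 = m" "nmem s0 ''c'' 0 = c"
  "v < n \<Longrightarrow> nmem s0 ''cell'' v = cell_index I (vs ! v)"
  "i < m \<Longrightarrow> nmem s0 ''left'' i = fst (es ! i)" "i < m \<Longrightarrow> nmem s0 ''right'' i = snd (es ! i)"
  "j < c \<Longrightarrow> nmem s0 ''join1'' j = fst (js ! j)" "j < c \<Longrightarrow> nmem s0 ''join2'' j = snd (js ! j)"
  "wmem s0 ''wmax'' 0 = ereal (wmax I)"
  by (simp_all add: input_store_def arr_def)

lemma s0_weight: "e \<in> Ed \<Longrightarrow> wmem s0 ''weight'' (e - 1) = wt I (edge e)"
  using Ed_mem(6)[of e] by (simp add: input_store_def arr_def edge_def L_def R_def split_def)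

lemma s0_zero:
  "nmem s0 ''own'' = (\<lambda>_. 0)" "nmem s0 ''d'' = (\<lambda>_. 0)" "nmem s0 ''al'' = (\<lambda>_. 0)"
  "nmem s0 ''vis'' = (\<lambda>_. 0)" "nmem s0 ''answer'' = (\<lambda>_. 0)"
  by (simp_all add: input_store_def)

lemma wt_nonneg: "e \<in> Ed \<Longrightarrow> 0 \<le> wt I (edge e)"
  using inst Ed_mem(5)[of e] unfolding cbm_instance_def by fastforce

text \<open>Each end of the edge lies in one cell only. As \<open>x\<close> and \<open>y\<close>
  differ, meeting both cells means that the two ends occupy them, in one order or the other.\<close>

lemma jn_iff:
  assumes e: "e \<in> Ed" and j: "j < c" and xy: "js ! j = (x, y)"
  shows "j \<in> jn e \<longleftrightarrow> edge e \<inter> cell I x \<noteq> {} \<and> edge e \<inter> cell I y \<noteq> {}"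
proof -
  have "(x, y) \<in> set js" using j xy by (metis nth_mem)
  then have "x < y" "{x, y} \<in> joins I" by (auto simp: js)
  then have ne: "x \<noteq> y" and r: "x \<in> {1..parts I}" "y \<in> {1..parts I}"
    by (auto elim!: joins_doubleton simp: doubleton_eq_iff)
  let ?a = "cell_index I (vs ! L e)" and ?b = "cell_index I (vs ! R e)"
  have "j \<in> jn e \<longleftrightarrow> ?a = x \<and> ?b = y \<or> ?a = y \<and> ?b = x"
    using Ed_mem[OF e] j xy s0_simps(4)[of "L e"] s0_simps(4)[of "R e"]
    by (simp add: jn_def join_of_def s0_simps L_def R_def Let_def)
  moreover have "vs ! L e \<in> verts I" "vs ! R e \<in> verts I"
    using Ed_mem[OF e] by (auto simp: verts_def)
  then have "edge e \<inter> cell I z \<noteq> {} \<longleftrightarrow> ?a = z \<or> ?b = z" if "z \<in> {1..parts I}" for z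
    using cell_iff that by (auto simp: edge_def)
  ultimately show ?thesis using r ne by auto
qed

text \<open>The cells of the two ends determine the unordered pair; listed joins have increasing
  components and no repetitions, so at most one of them matches.\<close>

lemma mask_bits:
  assumes e: "e \<in> Ed" and q: "mask_spec (join_of s0 (e - 1)) c q"
  shows "bits q = jn e" "q = 0 \<or> (\<exists>j. q = 2 ^ j)"
proof -
  have uniq: "j = j'" if "j < c" "j' < c" "join_of s0 (e - 1) j" "join_of s0 (e - 1) j'" for j j'
  proof -
    obtain x y x' y' where xy: "js ! j = (x, y)" "js ! j' = (x', y')" by (metis surj_pair)
    have "x < y" "x' < y'" using that xy nth_mem[of j js] nth_mem[of j' js] by (auto simp: js)
    moreover have "x = x' \<and> y = y' \<or> x = y' \<and> y = x'"
      using that xy by (auto simp: join_of_def s0_simps Let_def)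
    ultimately have "js ! j = js ! j'" using xy by auto
    then show ?thesis using js(1) that by (simp add: nth_eq_iff_index_eq)
  qed
  show "bits q = jn e" using q uniq unfolding mask_spec_def jn_def by auto
  show "q = 0 \<or> (\<exists>j. q = 2 ^ j)" using q unfolding mask_spec_def by auto
qed

definition perf :: "nat set \<Rightarrow> bool" where
  "perf Y \<longleftrightarrow> Y \<subseteq> Ed \<and> inj_on L Y \<and> inj_on R Y \<and> L ` Y \<union> R ` Y = {..<n}"

text \<open>Separates the part that depends on \<open>Y\<close>, which is \<open>pm\<close>, from
  the absence of isolated vertices, which does not.\<close>

lemma perf_iff:
  "perf Y \<longleftrightarrow> (Y \<subseteq> Ed \<and> inj_on L Y \<and> inj_on R Y \<and> L ` Y = L ` Ed \<and> R ` Y = R ` Ed) \<and>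
     L ` Ed \<union> R ` Ed = {..<n}" (is "_ \<longleftrightarrow> ?Q")
proof
  assume p: "perf Y"
  then have Y: "Y \<subseteq> Ed" and cov: "L ` Y \<union> R ` Y = {..<n}" by (auto simp: perf_def)
  have "L e \<in> L ` Y" "R e \<in> R ` Y" if e: "e \<in> Ed" for e
  proof -
    have "L e \<in> L ` Y \<union> R ` Y" "R e \<in> L ` Y \<union> R ` Y" using cov Ed_mem[OF e] by auto
    moreover have "L e \<noteq> R y" "R e \<noteq> L y" if "y \<in> Y" for y
      using L_neq_R e Y that by (metis subsetD)+
    then have "L e \<notin> R ` Y" "R e \<notin> L ` Y" by blast+
    ultimately show "L e \<in> L ` Y" "R e \<in> R ` Y" by auto
  qed
  then have "L ` Y = L ` Ed" "R ` Y = R ` Ed" using Y by auto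
  then show ?Q using p by (auto simp: perf_def)
qed (auto simp: perf_def)

lemma perfect_matching_iff:
  assumes Y: "Y \<subseteq> Ed"
  shows "perfect_matching I (edge ` Y) \<longleftrightarrow> perf Y"
proof -
  have "matching I (edge ` Y) \<longleftrightarrow> (\<forall>e\<in>Y. \<forall>e'\<in>Y. e \<noteq> e' \<longrightarrow> edge e \<inter> edge e' = {})"
  proof -
    have "edge ` Y \<subseteq> E I" using Y edge_image by auto
    moreover have "edge e = edge e' \<longleftrightarrow> e = e'" if "e \<in> Y" "e' \<in> Y" for e e'
      using inj_onD[OF inj_edge] that Y by auto
    ultimately show ?thesis unfolding matching_def pairwise_def disjnt_def by auto
  qed
  also have "\<dots> \<longleftrightarrow> inj_on L Y \<and> inj_on R Y"
  proof -
    have "edge e \<inter> edge e' = {} \<longleftrightarrow> L e \<noteq> L e' \<and> R e \<noteq> R e'" if "e \<in> Y" "e' \<in> Y" for e e'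
      using edge_Int that Y by auto
    then show ?thesis unfolding inj_on_def by auto
  qed
  finally have 1: "matching I (edge ` Y) \<longleftrightarrow> inj_on L Y \<and> inj_on R Y" .
  have "\<Union> (edge ` Y) = (!) vs ` (L ` Y \<union> R ` Y)" by (auto simp: edge_def)
  moreover have "verts I = (!) vs ` {..<n}"
    unfolding vs(2)[symmetric] by (auto simp: in_set_conv_nth)
  moreover have "inj_on ((!) vs) {..<n}" using nth_vs_eq by (auto simp: inj_on_def)
  moreover have "L ` Y \<union> R ` Y \<subseteq> {..<n}" using Ed_mem Y by auto
  ultimately have "\<Union> (edge ` Y) = verts I \<longleftrightarrow> L ` Y \<union> R ` Y = {..<n}"
    by (metis inj_on_image_eq_iff order_refl)
  then show ?thesis using 1 Y by (auto simp: perfect_matching_def perf_def)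
qed

lemma joins_iff:
  assumes Y: "Y \<subseteq> Ed"
  shows "(\<forall>i j. {i, j} \<in> joins I \<longrightarrow> satisfies_join I (edge ` Y) i j) \<longleftrightarrow> {..<c} \<subseteq> (\<Union>e\<in>Y. jn e)"
proof
  assume all: "\<forall>i j. {i, j} \<in> joins I \<longrightarrow> satisfies_join I (edge ` Y) i j"
  show "{..<c} \<subseteq> (\<Union>e\<in>Y. jn e)"
  proof
    fix j assume "j \<in> {..<c}"
    then have j: "j < c" by simp
    obtain x y where xy: "js ! j = (x, y)" by (metis surj_pair)
    then have "{x, y} \<in> joins I" using nth_mem[OF j] by (auto simp: js)
    then show "j \<in> (\<Union>e\<in>Y. jn e)"
      using all jn_iff[OF _ j xy] Y unfolding satisfies_join_def by blast
  qed
next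
  assume cov: "{..<c} \<subseteq> (\<Union>e\<in>Y. jn e)"
  have lt: "satisfies_join I (edge ` Y) x y" if xy: "(x, y) \<in> set js" for x y
  proof -
    have "\<exists>j<c. js ! j = (x, y)" using xy by (simp only: in_set_conv_nth)
    then obtain j where j: "j < c" "js ! j = (x, y)" by blast
    then obtain e where "e \<in> Y" "j \<in> jn e" using cov by auto
    then show ?thesis using jn_iff[OF _ j] Y unfolding satisfies_join_def by blast
  qed
  have sym: "satisfies_join I (edge ` Y) x y \<longleftrightarrow> satisfies_join I (edge ` Y) y x" for x y
    unfolding satisfies_join_def by auto
  show "\<forall>i j. {i, j} \<in> joins I \<longrightarrow> satisfies_join I (edge ` Y) i j"
  proof (intro allI impI)
    fix i j assume ij: "{i, j} \<in> joins I"
    then have "i \<noteq> j" by (auto elim!: joins_doubleton simp: doubleton_eq_iff)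
    then consider "(i, j) \<in> set js" | "(j, i) \<in> set js"
      using ij unfolding js(2) by (auto simp: insert_commute elim: linorder_neqE_nat)
    then show "satisfies_join I (edge ` Y) i j" using lt sym by cases blast+
  qed
qed

lemma yes_iff:
  "cbm_yes I \<longleftrightarrow> (\<exists>Y. perf Y \<and> {..<c} \<subseteq> (\<Union>e\<in>Y. jn e) \<and> (\<Sum>e\<in>Y. wt I (edge e)) \<le> ereal (wmax I))"
proof -
  have M: "\<exists>Y\<subseteq>Ed. M = edge ` Y" if "perfect_matching I M" for M
    using that subset_image_iff[of M edge Ed] unfolding edge_image perfect_matching_def matching_def by auto
  have sum: "(\<Sum>x\<in>edge ` Y. wt I x) = (\<Sum>e\<in>Y. wt I (edge e))" if "Y \<subseteq> Ed" for Y
    using sum.reindex[OF inj_on_subset[OF inj_edge that], of "wt I"] by simp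
  have perf_sub: "perf Y \<Longrightarrow> Y \<subseteq> Ed" for Y by (simp add: perf_def)
  show ?thesis
    unfolding cbm_yes_def using M sum perfect_matching_iff joins_iff perf_sub by (smt (verit))
qed

end

section \<open>Assembling the decision program\<close>

lemma mods_stages:
  "nmods powers = {''W'', ''j''}" "nmods join_masks = {''i'', ''j'', ''q'', ''pw''}"
  "nmods alternates = {''i'', ''j'', ''al''}"
  "nmods insertion = {''g'', ''i'', ''d'', ''cur'', ''t'', ''o'', ''own''}"
  "nmods coverage = {''ok'', ''i''}"
  "wmods powers = {}" "wmods join_masks = {}" "wmods alternates = {}" "wmods insertion = {}"
  "wmods coverage = {}"
  by (auto simp: powers_def join_masks_def join_mask_step_def alternates_def alternate_step_def
      insertion_def insert_edge_def walk_step_def coverage_def)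

definition decide :: com where
  "decide = Cond (NEq (Var ''ok'') (NConst 1))
     (fill_table ;;
      Cond (WLe (WRead ''T'' (NSub (Var ''W'') (NConst 1))) (WRead ''wmax'' (NConst 0)))
        (NSet ''answer'' (NConst 1)) Skip) Skip"

definition cbm_program :: com where
  "cbm_program = powers ;; join_masks ;; alternates ;; insertion ;; coverage ;; decide"

lemma mods_fill_table:
  "''answer'' \<notin> nmods fill_table" "''W'' \<notin> nmods fill_table" "''wmax'' \<notin> wmods fill_table"
  by (auto simp: fill_table_def init_table_def find_period_def process_block_def finish_block_def
      merge_tables_def block_step_def next_edge_def)

context encoded
begin

text \<open>If coverage fails, there is no perfect matching of the instance. If it holds, the held
  edges form one and no vertex is isolated, so the table over all \<open>pm\<close> sets
  decides.\<close>

lemma ok_decide: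
  assumes e: "edges Ed L al m"
    and al: "nmem s ''al'' = al"
    and pw: "\<forall>e\<in>Ed. mask_spec (join_of s0 (e - 1)) c (nmem s ''pw'' e)"
    and W: "nmem s ''W'' 0 = 2 ^ c"
    and inv: "two_choice.ins_inv Ed L R (nmem s ''own'') {v. nmem s ''d'' v \<noteq> 0} 0"
    and yes: "(\<exists>Y. two_choice.pm Ed L R Y) \<Longrightarrow> \<forall>e\<in>Ed. nmem s ''d'' (L e) \<noteq> 0"
    and cov: "nmem s ''ok'' 0 = (if \<forall>v<n. nmem s ''own'' v + nmem s ''d'' v \<noteq> 0 then 1 else 0)"
    and s: "\<And>x. x \<in> {''n'', ''m'', ''left'', ''right'', ''vis'', ''answer''} \<Longrightarrow> nmem s x = nmem s0 x"
      "wmem s = wmem s0"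
  shows "ok decide s ((n + 2) * ((m + 4) * ((2 ^ c + 1) * 1300)) + 80)
    (\<lambda>s'. nmem s' ''answer'' 0 = (if cbm_yes I then 1 else 0))"
proof -
  interpret E: edges Ed L R al m by (fact e)
  let ?own = "nmem s ''own''" and ?d = "nmem s ''d''"
  let ?X = "E.held ?own"
  have own: "?own b \<in> Ed" "R (?own b) = b" if "?own b \<noteq> 0" for b
    using that inv unfolding E.ins_inv_def by blast+
  have D: "L ` ?X = {v. ?d v \<noteq> 0}" using inv unfolding E.ins_inv_def by simp
  have X: "?X \<subseteq> Ed" "\<And>x. x \<in> ?X \<Longrightarrow> ?own (R x) = x" by (auto simp: E.held_def)
  have XI: "?own b \<in> ?X" if "?own b \<noteq> 0" for b using own[OF that] by (simp add: E.held_def)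
  have answer: "nmem s ''answer'' 0 = 0" using s(1)[of "''answer''"] s0_zero by simp
  show ?thesis
  proof (cases "\<forall>v<n. ?own v + ?d v \<noteq> 0")
    case False
    \<comment> \<open>By contradiction: if a perfect matching exists, all left ends are inserted,
      counting yields the right ends, and no vertex is isolated; so coverage would hold.\<close>
    have "\<not> cbm_yes I"
    proof
      assume "cbm_yes I"
      then obtain Y where "perf Y" unfolding yes_iff by auto
      then have pm: "E.pm Y" and all: "L ` Ed \<union> R ` Ed = {..<n}"
        unfolding perf_iff E.pm_def by auto
      have d: "\<forall>e\<in>Ed. ?d (L e) \<noteq> 0" using yes pm by auto
      then have "R ` ?X = R ` Ed" using pm inv by (intro E.held_covers_R) auto
      have "?own v + ?d v \<noteq> 0" if "v < n" for v
      proof -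
        have "v \<in> L ` Ed \<or> v \<in> R ` ?X" using that all \<open>R ` ?X = R ` Ed\<close> by auto
        then show ?thesis
        proof
          assume "v \<in> R ` ?X"
          then obtain x where "x \<in> ?X" "v = R x" by auto
          have "?own v = x" using X(2)[OF \<open>x \<in> ?X\<close>] unfolding \<open>v = R x\<close> .
          moreover have "x \<noteq> 0" using subsetD[OF X(1) \<open>x \<in> ?X\<close>] E.zero(1) by metis
          ultimately show ?thesis by simp
        qed (use d in auto)
      qed
      then show False using False by blast
    qed
    moreover have "nmem s ''ok'' 0 = 0" using cov unfolding if_not_P[OF False] .
    ultimately show ?thesis unfolding decide_def using answer
      by (intro ok_Cond[where bP = 1]) (auto intro: ok_run)
  next
    case True
    have dL: "?d (L e) \<noteq> 0" and oR: "?own (R e) \<noteq> 0" if e: "e \<in> Ed" for e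
    proof -
      \<comment> \<open>A nonzero entry \<open>own b\<close> is an edge with right end
        \<open>b\<close>, and a left position is never a right end. So coverage of a left position
        can only come from \<open>d\<close>.\<close>
      have "?own (L e) = 0" using own[of "L e"] L_neq_R[OF e, of "?own (L e)"] by metis
      then show "?d (L e) \<noteq> 0" using True Ed_mem(1)[OF e] by force
      have "R e \<notin> L ` ?X" using L_neq_R[OF _ e] X(1) by (metis imageE subsetD)
      then have "?d (R e) = 0" using D by auto
      then show "?own (R e) \<noteq> 0" using True Ed_mem(2)[OF e] by force
    qed
    have pmX: "E.pm ?X"
    proof (rule E.held_pm[OF inv])
      show "L ` Ed \<subseteq> L ` ?X" using dL D by auto
      have "R e \<in> R ` ?X" if "e \<in> Ed" for e
        using imageI[OF XI[OF oR[OF that]], of R] unfolding own(2)[OF oR[OF that]] .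
      then show "R ` Ed \<subseteq> R ` ?X" by blast
    qed
    have all: "L ` Ed \<union> R ` Ed = {..<n}"
    proof
      show "L ` Ed \<union> R ` Ed \<subseteq> {..<n}" using Ed_mem by auto
      show "{..<n} \<subseteq> L ` Ed \<union> R ` Ed"
      proof
        fix v assume "v \<in> {..<n}"
        then have "v < n" by simp
        then have "?own v + ?d v \<noteq> 0" by (rule True[rule_format])
        then consider "?own v \<noteq> 0" | "?d v \<noteq> 0" by linarith
        then show "v \<in> L ` Ed \<union> R ` Ed"
        proof cases
          case 1
          then show ?thesis using imageI[OF own(1)[of v], of R] unfolding own(2)[OF 1] by blast
        next
          case 2
          then have "v \<in> L ` ?X" using D by simp
          then show ?thesis using X(1) by auto
        qed
      qed
    qed
    have bits_pw: "bits (nmem s ''pw'' e) = jn e" if "e \<in> Ed" for e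
      using mask_bits(1)[OF that] pw that by blast
    define nx where "nx e = ?own (R (al e))" for e
    interpret dp Ed L R al m ?X nx ?own n "2 ^ c" "\<lambda>e. wt I (edge e)" "nmem s ''pw''"
    proof (unfold_locales, goal_cases)
      case 1 show ?case by (fact pmX)
    next
      case (2 e)
      then have "al e \<in> Ed" using X(1) E.al by auto
      then show ?case using XI oR by (simp add: nx_def)
    next
      case (3 e)
      then have "al e \<in> Ed" using X(1) E.al by auto
      then show ?case using own(2) oR by (simp add: nx_def)
    next
      case (4 e)
      then show ?case by (rule wt_nonneg)
    next
      case (5 e)
      then show ?case using mask_bits(2) pw by blast
    qed (use XI X Ed_mem in \<open>auto simp: nx_def\<close>)
    have ds: "dp_arrays s"
      using s al W s0_weight s0_simps Ed_mem(6)
      by (simp add: dp_arrays_def E.edge_arrays_def L_def R_def)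
    have vis: "nmem s ''vis'' = (\<lambda>_. 0)" using s(1)[of "''vis''"] s0_zero by simp
    \<comment> \<open>\<open>2 ^ c - 1\<close> codes the set of all joins and is the last index of
      the table.\<close>
    have yes': "best (\<lambda>e. wt I (edge e)) (nmem s ''pw'') {Y. E.pm Y} (2 ^ c - 1) \<le> ereal (wmax I) \<longleftrightarrow> cbm_yes I"
    proof -
      have "finite {Y. E.pm Y}" using E.fin unfolding E.pm_def by (auto intro: finite_subset[of _ "Pow Ed"])
      moreover have "perf Y \<longleftrightarrow> E.pm Y" for Y using all unfolding perf_iff E.pm_def by simp
      moreover have "(\<Union>e\<in>Y. bits (nmem s ''pw'' e)) = (\<Union>e\<in>Y. jn e)" if "E.pm Y" for Y
        using that bits_pw unfolding E.pm_def by (intro SUP_cong) auto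
      ultimately show ?thesis
        unfolding yes_iff by (simp add: best_le_iff bits_full[simplified])
    qed
    show ?thesis unfolding decide_def
    proof (rule ok_Cond[where bP = "(n + 2) * ((m + 4) * ((2 ^ c + 1) * 1300)) + 40"], goal_cases)
      case 1
      show ?case
      proof (rule ok_Seq[OF ok_fill_table[OF ds vis], where bQ = 40])
        fix s1 assume T: "table s1 ''T'' {Y. E.pm Y}"
          and H: "agree_off (nmods fill_table) (wmods fill_table) s s1"
        have 1: "nmem s1 ''answer'' 0 = 0" "nmem s1 ''W'' 0 = 2 ^ c" "wmem s1 ''wmax'' 0 = ereal (wmax I)"
          using agree_off_nmem[OF H] agree_off_wmem[OF H] mods_fill_table answer W s(2) s0_simps(9)
          by auto
        have "wmem s1 ''T'' (2 ^ c - 1) \<le> ereal (wmax I) \<longleftrightarrow> cbm_yes I"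
          using T yes' by (simp add: table_def)
        then show "ok (Cond (WLe (WRead ''T'' (NSub (Var ''W'') (NConst 1))) (WRead ''wmax'' (NConst 0)))
           (NSet ''answer'' (NConst 1)) Skip) s1 40
           (\<lambda>s'. nmem s' ''answer'' 0 = (if cbm_yes I then 1 else 0))"
          using 1 by (intro ok_run) auto
      qed simp
    next
      case 2
      then show ?case using True cov by simp
    qed simp
  qed
qed

definition time_bound :: nat where
  "time_bound = 100 * (c + 1) + ((m + 1) * (200 * (c + 1)) + ((m + 1) * (200 * (m + 1)) +
     ((m + 1) * (1000 * (m + 1)) + ((n + 1) * 100 +
     ((n + 2) * ((m + 4) * ((2 ^ c + 1) * 1300)) + 80)))))"

lemma ok_cbm_program:
  "ok cbm_program s0 time_bound (\<lambda>s'. nmem s' ''answer'' 0 = (if cbm_yes I then 1 else 0))"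
  unfolding cbm_program_def time_bound_def
proof (rule ok_Seq[OF ok_powers[OF s0_simps(3)] _ order_refl])
  let ?Q = "\<lambda>s'. nmem s' ''answer'' 0 = (if cbm_yes I then 1 else 0)"
  fix s1 assume W: "nmem s1 ''W'' 0 = 2 ^ c" and H1: "agree_off (nmods powers) (wmods powers) s0 s1"
  note f1 = agree_off_nmem[OF H1, unfolded mods_stages] agree_off_wmem[OF H1, unfolded mods_stages]
  have m1: "nmem s1 ''m'' 0 = m" "nmem s1 ''c'' 0 = c" using s0_simps f1 by auto
  have j1: "join_of s1 = join_of s0" using f1 by (simp add: join_of_def fun_eq_iff)
  show "ok (join_masks ;; alternates ;; insertion ;; coverage ;; decide) s1
     ((m + 1) * (200 * (c + 1)) + ((m + 1) * (200 * (m + 1)) +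
     ((m + 1) * (1000 * (m + 1)) + ((n + 1) * 100 +
     ((n + 2) * ((m + 4) * ((2 ^ c + 1) * 1300)) + 80))))) ?Q"
  proof (rule ok_Seq[OF ok_join_masks[OF m1] _ order_refl])
    fix s2 assume pw: "\<forall>i<m. mask_spec (join_of s1 i) c (nmem s2 ''pw'' (Suc i))"
      and H2: "agree_off (nmods join_masks) (wmods join_masks) s1 s2"
    note f2 = agree_off_nmem[OF H2, unfolded mods_stages] agree_off_wmem[OF H2, unfolded mods_stages]
    have m2: "nmem s2 ''m'' 0 = m" using f2 m1 by auto
    show "ok (alternates ;; insertion ;; coverage ;; decide) s2 ((m + 1) * (200 * (m + 1)) +
     ((m + 1) * (1000 * (m + 1)) + ((n + 1) * 100 +
     ((n + 2) * ((m + 4) * ((2 ^ c + 1) * 1300)) + 80)))) ?Q"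
    proof (rule ok_Seq[OF ok_alternates[OF m2] _ order_refl])
      fix s3 assume al: "nmem s3 ''al'' 0 = nmem s2 ''al'' 0 \<and>
          (\<forall>i<m. alt_spec (nmem s2 ''left'') m i (nmem s3 ''al'' (Suc i)))"
        and H3: "agree_off (nmods alternates) (wmods alternates) s2 s3"
      note f3 = agree_off_nmem[OF H3, unfolded mods_stages] agree_off_wmem[OF H3, unfolded mods_stages]
      let ?al = "nmem s3 ''al''"
      have left: "nmem s2 ''left'' i = L (Suc i)" if "i < m" for i
        using f1 f2 s0_simps(5) that by (simp add: L_def)
      have spec: "?al e \<in> Ed \<and> L (?al e) = L e \<and> (?al e = e \<longrightarrow> (\<forall>e'\<in>Ed. L e' = L e \<longrightarrow> e' = e))"
        if e: "e \<in> Ed" for e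
      proof -
        obtain i where i: "e = Suc i" "i < m" using e by (cases e) (auto simp: Ed_def)
        have E: "e' \<in> Ed \<longleftrightarrow> (\<exists>j<m. e' = Suc j)" for e' by (cases e') (auto simp: Ed_def)
        have "alt_spec (nmem s2 ''left'') m i (?al e)" using al i by auto
        then show ?thesis unfolding alt_spec_def using i left by (auto simp: E)
      qed
      have al0: "?al 0 = 0" using al f1 f2 s0_zero by simp
      interpret E: edges Ed L R ?al m
      proof (unfold_locales, goal_cases)
        case (6 e e')
        \<comment> \<open>If \<open>al e = e\<close>, no other edge shares the left end; otherwise a
          third edge there would violate the degree bound.\<close>
        then show ?case using spec[of e] edges_at_two[of e e' "?al e"] by metis
      qed (use spec al0 in \<open>auto simp: Ed_def\<close>)
      have ea: "E.edge_arrays s3"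
        using f1 f2 f3 s0_simps Ed_mem(6) by (simp add: E.edge_arrays_def L_def R_def)
      have z3: "nmem s3 ''own'' = (\<lambda>_. 0)" "nmem s3 ''d'' = (\<lambda>_. 0)"
        using f1 f2 f3 s0_zero by auto
      show "ok (insertion ;; coverage ;; decide) s3
       ((m + 1) * (1000 * (m + 1)) + ((n + 1) * 100 +
        ((n + 2) * ((m + 4) * ((2 ^ c + 1) * 1300)) + 80))) ?Q"
      proof (rule ok_Seq[OF E.ok_insertion[OF ea z3] _ order_refl])
        fix s4 assume ins: "E.ins_inv (nmem s4 ''own'') {v. nmem s4 ''d'' v \<noteq> 0} 0 \<and>
            ((\<exists>Y. E.pm Y) \<longrightarrow> (\<forall>e\<in>Ed. nmem s4 ''d'' (L e) \<noteq> 0))"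
          and H4: "agree_off (nmods insertion) (wmods insertion) s3 s4"
        note f4 = agree_off_nmem[OF H4, unfolded mods_stages] agree_off_wmem[OF H4, unfolded mods_stages]
        have n4: "nmem s4 ''n'' 0 = n" using f1 f2 f3 f4 s0_simps by auto
        show "ok (coverage ;; decide) s4 ((n + 1) * 100 +
          ((n + 2) * ((m + 4) * ((2 ^ c + 1) * 1300)) + 80)) ?Q"
        proof (rule ok_Seq[OF ok_coverage[OF n4] _ order_refl])
          fix s5 assume cov: "nmem s5 ''ok'' 0 =
              (if \<forall>v<n. nmem s4 ''own'' v + nmem s4 ''d'' v \<noteq> 0 then 1 else 0)"
            and H5: "agree_off (nmods coverage) (wmods coverage) s4 s5"
          note f5 = agree_off_nmem[OF H5, unfolded mods_stages] agree_off_wmem[OF H5, unfolded mods_stages]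
          have od: "nmem s5 ''own'' = nmem s4 ''own''" "nmem s5 ''d'' = nmem s4 ''d''" using f5 by auto
          show "ok decide s5 ((n + 2) * ((m + 4) * ((2 ^ c + 1) * 1300)) + 80) ?Q"
          proof (rule ok_decide[OF E.edges_axioms])
            show "nmem s5 ''al'' = ?al" using f4 f5 by simp
            show "nmem s5 ''W'' 0 = 2 ^ c" using W f2 f3 f4 f5 by simp
            show "\<forall>e\<in>Ed. mask_spec (join_of s0 (e - 1)) c (nmem s5 ''pw'' e)"
            proof
              fix e assume e: "e \<in> Ed"
              then obtain i where "e = Suc i" "i < m" by (cases e) (auto simp: Ed_def)
              then show "mask_spec (join_of s0 (e - 1)) c (nmem s5 ''pw'' e)"
                using pw j1 f3 f4 f5 by simp
            qed
            show "nmem s5 x = nmem s0 x" if "x \<in> {''n'', ''m'', ''left'', ''right'', ''vis'', ''answer''}" for x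
              using that f1 f2 f3 f4 f5 by (elim insertE emptyE) simp_all
            show "wmem s5 = wmem s0" using f1 f2 f3 f4 f5 by (simp add: fun_eq_iff)
          qed (use ins cov od in auto)
        qed
      qed
    qed
  qed
qed

text \<open>Each summand is compared with \<open>P\<close>. The coefficients, including the constant
  80, add up to 58580, rounded up to 60000.\<close>

lemma time_bound_le:
  assumes n: "n \<ge> 1"
  shows "time_bound \<le> 60000 * (2 ^ (c * (c + 1)) * n + n ^ 3)"
proof -
  define W P where "W = (2::nat) ^ c" and "P = n * n * W"
  have W: "c + 1 \<le> W" "1 \<le> W" using less_exp[of c] by (auto simp: Suc_le_eq W_def)
  \<comment> \<open>From \<open>m \<le> 2 * n\<close> and \<open>1 \<le> n\<close>.\<close>
  have m: "m + 1 \<le> 3 * n" "m + 4 \<le> 6 * n" using m_le n by linarith+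
  have nn: "n \<le> n * n" using n by simp
  have Ps: "n * n \<le> P" "W \<le> P" "n \<le> P" "1 \<le> P" "n * W \<le> P"
    using W(2) n nn unfolding P_def by (auto intro: order_trans[OF nn])
  have 1: "100 * (c + 1) \<le> 100 * P" using order_trans[OF W(1) Ps(2)] by (rule mult_le_mono2)
  have "(m + 1) * (200 * (c + 1)) \<le> (3 * n) * (200 * W)" using m W by (intro mult_le_mono) auto
  then have 2: "(m + 1) * (200 * (c + 1)) \<le> 600 * P" using Ps(5) by (simp add: mult.assoc)
  have "(m + 1) * (1000 * (m + 1)) \<le> (3 * n) * (1000 * (3 * n))"
    "(m + 1) * (200 * (m + 1)) \<le> (3 * n) * (200 * (3 * n))"
    using m by (intro mult_le_mono; simp)+
  then have 3: "(m + 1) * (1000 * (m + 1)) \<le> 9000 * P" "(m + 1) * (200 * (m + 1)) \<le> 1800 * P"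
    using Ps(1) by simp_all
  have 4: "(n + 1) * 100 \<le> 200 * P" using Ps(3,4) by simp
  have "(n + 2) * ((m + 4) * ((W + 1) * 1300)) \<le> (3 * n) * ((6 * n) * ((2 * W) * 1300))"
    by (intro mult_le_mono; use m n W in linarith)
  then have 5: "(n + 2) * ((m + 4) * ((W + 1) * 1300)) \<le> 46800 * P" by (simp add: P_def algebra_simps)
  have "time_bound \<le> 60000 * P"
    unfolding time_bound_def W_def[symmetric] using 1 2 3 4 5 Ps(4) by linarith
  also have "P \<le> 2 ^ (c * (c + 1)) * n + n ^ 3"
  proof (cases "W \<le> n")
    case True
    then have "P \<le> n * n * n" by (simp add: P_def)
    then show ?thesis by (simp add: power3_eq_cube)
  next
    case False
    \<comment> \<open>For \<open>c = 0\<close> the table has \<open>W = 1 \<le> n\<close> entries,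
      contrary to the case assumption.\<close>
    then have "c \<noteq> 0" using n by (intro notI) (auto simp: W_def)
    then have "2 * c \<le> c * (c + 1)" by (cases c) auto
    then have "(2::nat) ^ (2 * c) \<le> 2 ^ (c * (c + 1))" by (rule power_increasing) simp
    moreover have "(2::nat) ^ (2 * c) = W * W" by (simp add: W_def mult_2 power_add)
    moreover have "n * (n * W) \<le> W * (n * W)" using False by (intro mult_le_mono1) simp
    then have "P \<le> W * W * n" by (simp add: P_def mult.assoc mult.commute)
    ultimately have "P \<le> 2 ^ (c * (c + 1)) * n"
      using mult_le_mono1[of "W * W" "2 ^ (c * (c + 1))" n] by linarith
    then show ?thesis by linarith
  qed
  finally show ?thesis by simp
qed

end

text \<open>The time claim is restricted to nonempty graphs because the bound is 0 for
  \<open>n = 0\<close>, while every program takes at least one step. Correctness of the answer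
  carries no such restriction.\<close>

theorem mainTheorem13:
  "\<exists>(P :: com) (K :: nat). \<forall>(I :: cbm) (s :: store).
     cbm_instance I \<and> (\<forall>v\<in>V1 I. degree I v \<le> 2) \<and> represents s I \<longrightarrow>
     (\<exists>t s'. exec P s t s' \<and>
        nmem s' ''answer'' 0 = (if cbm_yes I then 1 else 0) \<and>
        (let n = card (verts I); c = card (joins I)
         in n \<ge> 1 \<longrightarrow> t \<le> K * (2 ^ (c * (c + 1)) * n + n ^ 3)))"
proof (rule exI[of _ cbm_program], rule exI[of _ 60000], intro allI impI)
  fix I s
  assume A: "cbm_instance I \<and> (\<forall>v\<in>V1 I. degree I v \<le> 2) \<and> represents s I"
  then obtain vs es js where "encoded I vs es js" and s: "s = input_store I vs es js"
    unfolding represents_def encoded_def by blast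
  then interpret encoded I vs es js by simp
  obtain t s' where "exec cbm_program s t s'" "t \<le> time_bound"
    "nmem s' ''answer'' 0 = (if cbm_yes I then 1 else 0)"
    using ok_cbm_program unfolding ok_def s by blast
  then show "\<exists>t s'. exec cbm_program s t s' \<and>
        nmem s' ''answer'' 0 = (if cbm_yes I then 1 else 0) \<and>
        (let n = card (verts I); c = card (joins I)
         in n \<ge> 1 \<longrightarrow> t \<le> 60000 * (2 ^ (c * (c + 1)) * n + n ^ 3))"
    using time_bound_le unfolding card_verts card_joins Let_def by (meson le_trans)
qed

end
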